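(* Fix an integer $k\ge1$ and a totally ordered alphabet $\mathcal A$, and let $x\in\mathcal A^n$. Run the RSK (row-insertion) algorithm on $x$. During the algorithm, some letters are bumped out of the $k$th row and inserted into the $(k+1)$th row; let $x^{(k)}$ be the string of these letters in the order in which they are bumped. Let $\bar x$ be the subsequence of $x$ consisting of those same letter occurrences, in the order they appear in $x$. Then $\mathrm{shRSK}(\bar x)\trianglerighteq\mathrm{shRSK}(x^{(k)})$.
   Context: $\mathrm{shRSK}(y)$ is the common shape (a Young diagram, i.e. partition of the length of $y$) of the tableaux produced by RSK on $y$; equivalently its first $j$ rows sum to the maximum total length of a union of $j$ disjoint weakly increasing subsequences of $y$. For partitions $\lambda,\mu$ of the same integer, $\lambda\trianglerighteq\mu$ (dominance/majorization) means $\lambda_1+\cdots+\lambda_j\ge\mu_1+\cdots+\mu_j$ for every $j$. *)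

theory Defs
  imports Main
begin

text \<open>Letter occurrences are tagged by their position in the input word
  (pair (letter, position)); all comparisons use only the letter (fst).
  A tableau is a list of rows, row 1 first.\<close>

type_synonym 'a entry = "'a \<times> nat"
type_synonym 'a tableau = "'a entry list list"

fun ins_row :: "('a::linorder) entry \<Rightarrow> 'a entry list \<Rightarrow> 'a entry list \<times> 'a entry option" where
  "ins_row a [] = ([a], None)"
| "ins_row a (b # r) =
     (if fst a < fst b then (a # r, Some b)
      else (case ins_row a r of (r', c) \<Rightarrow> (b # r', c)))"

text \<open>Insertion of an entry into the tableau starting at row number i.
  Returns the new tableau and the list of bump events (j, b): entry b was
  bumped out of row j and inserted into row j+1.\<close>
fun ins_tab :: "('a::linorder) entry \<Rightarrow> nat \<Rightarrow> 'a tableau \<Rightarrow> 'a tableau \<times> (nat \<times> 'a entry) list" where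
  "ins_tab a i [] = ([[a]], [])"
| "ins_tab a i (r # rs) =
     (case ins_row a r of
        (r', None) \<Rightarrow> (r' # rs, [])
      | (r', Some b) \<Rightarrow> (case ins_tab b (Suc i) rs of (rs', ev) \<Rightarrow> (r' # rs', (i, b) # ev)))"

fun rsk_aux :: "('a::linorder) tableau \<Rightarrow> 'a entry list \<Rightarrow> 'a tableau \<times> (nat \<times> 'a entry) list" where
  "rsk_aux T [] = (T, [])"
| "rsk_aux T (a # as) =
     (case ins_tab a 1 T of (T', ev) \<Rightarrow>
        (case rsk_aux T' as of (T'', ev') \<Rightarrow> (T'', ev @ ev')))"

definition rsk_run :: "('a::linorder) list \<Rightarrow> 'a tableau \<times> (nat \<times> 'a entry) list" where
  "rsk_run x = rsk_aux [] (zip x [0..<length x])"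

definition shRSK :: "('a::linorder) list \<Rightarrow> nat list" where
  "shRSK x = map length (fst (rsk_run x))"

definition bumped_word :: "nat \<Rightarrow> ('a::linorder) list \<Rightarrow> 'a list" where
  "bumped_word k x = [fst b. (j, b) \<leftarrow> snd (rsk_run x), j = k]"

definition bumped_positions :: "nat \<Rightarrow> ('a::linorder) list \<Rightarrow> nat set" where
  "bumped_positions k x = {snd b | j b. (j, b) \<in> set (snd (rsk_run x)) \<and> j = k}"

definition xbar :: "nat \<Rightarrow> ('a::linorder) list \<Rightarrow> 'a list" where
  "xbar k x = nths x (bumped_positions k x)"

definition dominates :: "nat list \<Rightarrow> nat list \<Rightarrow> bool" where
  "dominates lam mu \<longleftrightarrow> sum_list lam = sum_list mu \<and>
     (\<forall>j. sum_list (take j mu) \<le> sum_list (take j lam))"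

end

theory Submission
  imports Defs
begin

text \<open>
  A single row fed with a word \<open>w\<close> keeps \<open>row w\<close> and bumps out \<open>out w\<close>; the \<open>k\<close>-th bumped word is
  \<open>out\<^sup>k x\<close>, and the first \<open>j\<close> rows of the shape hold \<open>|w| - |out\<^sup>j w|\<close> boxes, which by Greene's
  theorem is the largest size of a union of \<open>j\<close> disjoint increasing subsequences. The claim thus is
  \<open>|out\<^sup>e x\<^sub>S| \<le> |out\<^sup>k\<^sup>+\<^sup>e x|\<close>, where \<open>S\<close> consists of the letters of \<open>out\<^sup>k x\<close> and \<open>x\<^sub>S\<close> is the restriction
  of \<open>x\<close> to \<open>S\<close>.

  After standardising \<open>x\<close>, let \<open>v\<^sub>q\<close> consist of the letters of \<open>x\<close> that are at most \<open>q\<close> or belong to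
  \<open>S\<close>, and append to it a filler \<open>X\<^sub>q\<close>: the block \<open>z\<^sub>k\<^sup>n \<dots> z\<^sub>1\<^sup>n\<close> of new letters \<open>z\<^sub>1 < \<dots> < z\<^sub>k\<close> with values
  strictly between \<open>q\<close> and the next letter of \<open>x\<close>. At the lower end \<open>X\<^sub>0\<close> lies below all of \<open>x\<^sub>S\<close> and just
  pushes its tableau down by \<open>k\<close> rows; at the upper end the filler lies above all of \<open>x\<close> and never leaves
  the first \<open>k\<close> rows. In between, \<open>|out\<^sup>k\<^sup>+\<^sup>e (v\<^sub>q X\<^sub>q)|\<close> is nondecreasing in \<open>q\<close>. Indeed, let \<open>y\<close> be the next
  letter. Whether \<open>y\<close> is missing from \<open>v\<^sub>q\<close> or belongs to \<open>S\<close>, it is not in the first \<open>k\<close> rows of the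
  tableau of \<open>v\<^sub>q\<close>, and the filler stays in these rows, so moving the values of the filler from below \<open>y\<close>
  to above \<open>y\<close> changes no bumping decision. Inserting \<open>y\<close> in case \<open>y \<notin> S\<close> enlarges the word by one letter
  but, by Greene's theorem, the first \<open>k + e\<close> rows by at most one box.
\<close>

section \<open>Insertion into a single row\<close>

text \<open>The comparison is a parameter because insertion is studied for three relations: letters
  alone, letters with ties broken by position, and \<open><\<close> on a linear order.\<close>

fun bump :: "('b \<Rightarrow> 'b \<Rightarrow> bool) \<Rightarrow> 'b \<Rightarrow> 'b list \<Rightarrow> 'b list \<times> 'b option" where
  "bump lt a [] = ([a], None)"
| "bump lt a (b # r) =
     (if lt a b then (a # r, Some b)
      else (case bump lt a r of (r', c) \<Rightarrow> (b # r', c)))"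

fun run :: "('b \<Rightarrow> 'b \<Rightarrow> bool) \<Rightarrow> 'b list \<Rightarrow> 'b list \<Rightarrow> 'b list \<times> 'b list" where
  "run lt r [] = (r, [])"
| "run lt r (a # w) =
     (case bump lt a r of (r', c) \<Rightarrow>
        (case run lt r' w of (r'', out) \<Rightarrow>
           (r'', (case c of None \<Rightarrow> out | Some b \<Rightarrow> b # out))))"

definition row :: "('b \<Rightarrow> 'b \<Rightarrow> bool) \<Rightarrow> 'b list \<Rightarrow> 'b list" where
  "row lt w = fst (run lt [] w)"

definition out :: "('b \<Rightarrow> 'b \<Rightarrow> bool) \<Rightarrow> 'b list \<Rightarrow> 'b list" where
  "out lt w = snd (run lt [] w)"

lemma bump_cases:
  obtains (append) "bump lt a r = (r @ [a], None)" "\<forall>x\<in>set r. \<not> lt a x"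
  | (replace) u b v where "r = u @ b # v" "bump lt a r = (u @ a # v, Some b)"
      "\<forall>x\<in>set u. \<not> lt a x" "lt a b"
proof (induction r arbitrary: thesis)
  case Nil
  then show ?case by simp
next
  case (Cons c r)
  show ?case
  proof (cases "lt a c")
    case True
    then show ?thesis using Cons.prems(2)[of "[]" c r] by simp
  next
    case False
    show ?thesis
    proof (rule Cons.IH)
      assume "bump lt a r = (r @ [a], None)" "\<forall>x\<in>set r. \<not> lt a x"
      then show thesis using False Cons.prems(1) by simp
    next
      fix u b v assume "r = u @ b # v" "bump lt a r = (u @ a # v, Some b)"
      "\<forall>x\<in>set u. \<not> lt a x" "lt a b"
      then show thesis using False Cons.prems(2)[of "c # u" b v] by simp
    qed
  qed
qed

lemma run_append:
  "run lt r (u @ w) =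
    (fst (run lt (fst (run lt r u)) w), snd (run lt r u) @ snd (run lt (fst (run lt r u)) w))"
  by (induction u arbitrary: r) (auto split: prod.splits option.splits)

lemma out_append: "out lt (u @ w) = out lt u @ snd (run lt (row lt u) w)"
  unfolding row_def out_def by (simp add: run_append[of _ "[]"])

lemma out_Nil [simp]: "out lt [] = []"
  by (simp add: out_def)

lemma out_pow_Nil [simp]: "(out lt ^^ j) [] = []"
  by (induction j) simp_all

lemma out_pow_Suc: "(out lt ^^ Suc j) w = (out lt ^^ j) (out lt w)"
  by (simp only: funpow_Suc_right comp_apply)

section \<open>Sizes and letter sets under insertion\<close>

lemma set_bump: "set (fst (bump lt a r)) \<union> set_option (snd (bump lt a r)) = insert a (set r)"
  by (rule bump_cases[of lt a r]) auto

lemma length_run: "length (fst (run lt r w)) + length (snd (run lt r w)) = length r + length w"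
proof (induction w arbitrary: r)
  case (Cons a w)
  have "length (fst (bump lt a r)) + (case snd (bump lt a r) of None \<Rightarrow> 0 | Some b \<Rightarrow> 1) = Suc (length r)"
    by (rule bump_cases[of lt a r]) auto
  then show ?case
    using Cons[of "fst (bump lt a r)"] by (auto split: prod.splits option.splits)
qed simp

lemma set_run: "set (fst (run lt r w)) \<union> set (snd (run lt r w)) = set r \<union> set w"
proof (induction w arbitrary: r)
  case (Cons a w)
  obtain r' c where r': "bump lt a r = (r', c)" by fastforce
  have "set (fst (run lt r (a # w))) \<union> set (snd (run lt r (a # w))) =
      set_option c \<union> (set (fst (run lt r' w)) \<union> set (snd (run lt r' w)))"
    using r' by (auto split: prod.splits option.splits)
  also have "\<dots> = set_option c \<union> set r' \<union> set w"
    by (simp only: Cons.IH Un_assoc)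
  also have "\<dots> = set r \<union> set (a # w)"
    using set_bump[of lt a r] r' by auto
  finally show ?case .
qed simp

lemma length_row_out: "length (row lt w) + length (out lt w) = length w"
  using length_run[of lt "[]" w] by (simp add: row_def out_def)

lemma set_row_out: "set (row lt w) \<union> set (out lt w) = set w"
  using set_run[of lt "[]" w] by (simp add: row_def out_def)

lemma length_out_pow_le: "length ((out lt ^^ j) w) \<le> length w"
proof (induction j)
  case (Suc j)
  then show ?case using length_row_out[of lt "(out lt ^^ j) w"] by simp
qed simp

lemma set_out_pow: "set ((out lt ^^ j) w) \<subseteq> set w"
proof (induction j)
  case (Suc j)
  then show ?case using set_row_out[of lt "(out lt ^^ j) w"] by auto
qed simp

lemma length_run_row: "length r \<le> length (fst (run lt r w))"
proof (induction w arbitrary: r)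
  case (Cons a w)
  have "length r \<le> length (fst (bump lt a r))"
    by (rule bump_cases[of lt a r]) auto
  then show ?case
    using Cons[of "fst (bump lt a r)"] by (auto split: prod.splits)
qed simp

lemma row_nonempty: "w \<noteq> [] \<Longrightarrow> row lt w \<noteq> []"
  using length_run_row[of "[hd w]" lt "tl w"] by (cases w) (auto simp: row_def split: prod.splits)

lemma length_out_less: "w \<noteq> [] \<Longrightarrow> length (out lt w) < length w"
  using row_nonempty[of w lt] length_row_out[of lt w] by (cases "row lt w") auto

lemma bump_map:
  assumes "\<forall>b\<in>set r. lt' (f a) (f b) \<longleftrightarrow> lt a b"
  shows "bump lt' (f a) (map f r) = map_prod (map f) (map_option f) (bump lt a r)"
  using assms by (induction r) (auto split: prod.splits)

lemma run_map:
  assumes "\<forall>a\<in>A. \<forall>b\<in>A. lt' (f a) (f b) \<longleftrightarrow> lt a b" "set r \<subseteq> A" "set w \<subseteq> A"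
  shows "run lt' (map f r) (map f w) = map_prod (map f) (map f) (run lt r w)"
  using assms(2,3)
proof (induction w arbitrary: r)
  case (Cons a w)
  have "bump lt' (f a) (map f r) = map_prod (map f) (map_option f) (bump lt a r)"
    by (rule bump_map) (use assms(1) Cons.prems in auto)
  moreover have "set (fst (bump lt a r)) \<subseteq> A"
    using set_bump[of lt a r] Cons.prems by auto
  ultimately show ?case
    using Cons.IH[of "fst (bump lt a r)"] Cons.prems
    by (auto split: prod.splits option.splits)
qed simp

text \<open>Bumping depends on comparisons only. A non-injective \<open>f\<close> is allowed, so
  this covers forgetting the positions as well as replacing letters by ranks.\<close>

lemma out_pow_map:
  assumes "\<forall>a\<in>set w. \<forall>b\<in>set w. lt' (f a) (f b) \<longleftrightarrow> lt a b"
  shows "(out lt' ^^ j) (map f w) = map f ((out lt ^^ j) w)"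
proof (induction j)
  case (Suc j)
  have "run lt' (map f []) (map f ((out lt ^^ j) w)) = map_prod (map f) (map f) (run lt [] ((out lt ^^ j) w))"
    by (rule run_map[where A = "set w"]) (use assms set_out_pow[of j lt w] in auto)
  then have "out lt' (map f ((out lt ^^ j) w)) = map f (out lt ((out lt ^^ j) w))"
    by (simp add: out_def)
  then show ?case using Suc by simp
qed simp

section \<open>Unions of increasing subsequences and Knuth moves\<close>

lemma sorted_bump:
  assumes "sorted r"
  shows "sorted (fst (bump (<) (a :: 'b :: linorder) r))"
  by (rule bump_cases[of "(<)" a r]) (use assms in \<open>fastforce simp: sorted_append\<close>)+

lemma sorted_run: "sorted r \<Longrightarrow> sorted (fst (run (<) r (w :: 'b :: linorder list)))"
proof (induction w arbitrary: r)
  case (Cons a w)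
  show ?case using sorted_bump[of r a] Cons.prems Cons.IH[of "fst (bump (<) a r)"]
    by (auto split: prod.splits)
qed simp

lemma sorted_row: "sorted (row (<) (w :: 'b :: linorder list))"
  by (simp add: row_def sorted_run)

text \<open>A letter of colour \<open>c < j\<close> belongs to the \<open>c\<close>-th of \<open>j\<close> disjoint weakly increasing
  subsequences; a letter of colour at least \<open>j\<close> belongs to none of them.\<close>

definition compat :: "nat \<Rightarrow> ('b :: linorder \<times> nat) \<Rightarrow> ('b \<times> nat) \<Rightarrow> bool" where
  "compat j x y \<longleftrightarrow> (snd x = snd y \<and> snd x < j \<longrightarrow> fst x \<le> fst y)"

definition coverable :: "nat \<Rightarrow> 'b :: linorder list \<Rightarrow> nat \<Rightarrow> bool" where
  "coverable j w m \<longleftrightarrow>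
    (\<exists>p. map fst p = w \<and> sorted_wrt (compat j) p \<and> m \<le> length (filter (\<lambda>x. snd x < j) p))"

text \<open>Applied to the part of the word behind a Knuth move, this lets two subsequences exchange
  their tails.\<close>

definition swap_col :: "nat \<Rightarrow> nat \<Rightarrow> 'b \<times> nat \<Rightarrow> 'b \<times> nat" where
  "swap_col c d x = (fst x, if snd x = c then d else if snd x = d then c else snd x)"

lemma swap_col_simps [simp]:
  "fst (swap_col c d x) = fst x"
  "snd (swap_col c d x) = (if snd x = c then d else if snd x = d then c else snd x)"
  by (simp_all add: swap_col_def)

lemma sorted_wrt_swap_col:
  assumes "c < j" "d < j" "sorted_wrt (compat j) p"
  shows "sorted_wrt (compat j) (map (swap_col c d) p)"
  unfolding sorted_wrt_map
  by (rule sorted_wrt_mono_rel[OF _ assms(3)]) (use assms in \<open>auto simp: compat_def split: if_splits\<close>)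

lemma filter_swap_col:
  assumes "c < j" "d < j"
  shows "length (filter (\<lambda>x. snd x < j) (map (swap_col c d) p)) = length (filter (\<lambda>x. snd x < j) p)"
  using assms by (induction p) auto

lemma coverableE3:
  assumes "coverable j (L @ [x, y, z] @ M) m"
  obtains pl a b c pm where "map fst pl = L" "map fst pm = M"
    "sorted_wrt (compat j) (pl @ [(x, a), (y, b), (z, c)] @ pm)"
    "m \<le> length (filter (\<lambda>x. snd x < j) (pl @ [(x, a), (y, b), (z, c)] @ pm))"
proof -
  obtain p where p: "map fst p = L @ [x, y, z] @ M" "sorted_wrt (compat j) p"
     "m \<le> length (filter (\<lambda>x. snd x < j) p)"
    using assms unfolding coverable_def by auto
  from p(1) obtain pl q1 q2 q3 pm where "p = pl @ [q1, q2, q3] @ pm" "map fst pl = L"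
    "map fst pm = M" "fst q1 = x" "fst q2 = y" "fst q3 = z"
    by (auto simp: map_eq_append_conv map_eq_Cons_conv)
  moreover from this have "[q1, q2, q3] = [(x, snd q1), (y, snd q2), (z, snd q3)]" by auto
  ultimately show ?thesis
    using that[of pl pm "snd q1" "snd q2" "snd q3"] p by metis
qed

lemma coverableI:
  assumes "map fst p = w" "sorted_wrt (compat j) p" "m \<le> length (filter (\<lambda>x. snd x < j) p)"
  shows "coverable j w m"
  using assms unfolding coverable_def by blast

text \<open>The value \<open>y\<close> separates the letters of the two colours in \<open>p\<close>
  from those in \<open>q\<close>, so either subsequence may be continued by either tail.\<close>

lemma compat_swap_col:
  assumes "sorted_wrt (compat j) (p @ q)"
    and "\<forall>x\<in>set p. snd x = c \<or> snd x = d \<longrightarrow> fst x \<le> y"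
    and "\<forall>x\<in>set q. snd x = c \<or> snd x = d \<longrightarrow> y \<le> fst x"
  shows "\<forall>x\<in>set p. \<forall>x'\<in>set q. compat j x (swap_col c d x')"
proof (intro ballI)
  fix x x' assume x: "x \<in> set p" and x': "x' \<in> set q"
  then have "compat j x x'" using assms(1) by (auto simp: sorted_wrt_append)
  then show "compat j x (swap_col c d x')"
  proof (cases "(snd x = c \<or> snd x = d) \<and> (snd x' = c \<or> snd x' = d)")
    case True
    then have "fst x \<le> y" "y \<le> fst x'"
      using assms(2,3) x x' by blast+
    then have "fst x \<le> fst x'" by (rule order_trans)
    then show ?thesis by (simp add: compat_def)
  qed (auto simp: compat_def)
qed

text \<open>In \<open>y z x\<close> the descent from \<open>z\<close> to \<open>x\<close> excludes a
  common subsequence, so transposing them with their colours is harmless. In the converse direction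
  the only obstruction is a common colour \<open>c\<close> of \<open>x\<close> and \<open>z\<close>;
  it is removed by recolouring with the help of \<open>y\<close>.\<close>

lemma coverable_knuth1:
  assumes "x < y" "y \<le> z"
  shows "coverable j (L @ [y, z, x] @ M) m \<longleftrightarrow> coverable j (L @ [y, x, z] @ M) m"
proof
  assume "coverable j (L @ [y, z, x] @ M) m"
  then obtain pl a b c pm where p: "map fst pl = L" "map fst pm = M"
    "sorted_wrt (compat j) (pl @ [(y, a), (z, b), (x, c)] @ pm)"
    "m \<le> length (filter (\<lambda>x. snd x < j) (pl @ [(y, a), (z, b), (x, c)] @ pm))"
    by (rule coverableE3)
  show "coverable j (L @ [y, x, z] @ M) m"
    by (rule coverableI[of "pl @ [(y, a), (x, c), (z, b)] @ pm"])
      (use p assms in \<open>auto simp: sorted_wrt_append compat_def\<close>)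
next
  assume "coverable j (L @ [y, x, z] @ M) m"
  then obtain pl d c b pm where p: "map fst pl = L" "map fst pm = M"
    "sorted_wrt (compat j) (pl @ [(y, d), (x, c), (z, b)] @ pm)"
    "m \<le> length (filter (\<lambda>x. snd x < j) (pl @ [(y, d), (x, c), (z, b)] @ pm))"
    by (rule coverableE3)
  consider "\<not> (c = b \<and> c < j)" | "c = b" "c < j" "\<not> d < j" | "c = b" "c < j" "d < j" by blast
  then show "coverable j (L @ [y, z, x] @ M) m"
  proof cases
    case 1
    show ?thesis
      by (rule coverableI[of "pl @ [(y, d), (z, b), (x, c)] @ pm"])
        (use p assms 1 in \<open>auto simp: sorted_wrt_append compat_def\<close>)
  next
    \<comment> \<open>The uncovered \<open>y\<close> takes the place of \<open>x\<close> in the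
      subsequence \<open>c\<close>, and \<open>x\<close> becomes uncovered.\<close>
    case 2
    have pm: "\<forall>q\<in>set pm. compat j (z, c) q" and pl: "\<forall>q\<in>set pl. compat j q (x, c)"
      and plm: "sorted_wrt (compat j) (pl @ pm)"
      using p(3) 2 by (auto simp: sorted_wrt_append)
    have "\<forall>q\<in>set pl. compat j q (y, c) \<and> compat j q (z, c) \<and> compat j q (x, d) \<and> compat j q (z, d)"
      using pl 2 assms by (force simp: compat_def)
    moreover have "\<forall>q\<in>set pm. compat j (y, c) q \<and> compat j (x, c) q \<and> compat j (x, d) q \<and> compat j (z, d) q"
      using pm 2 assms by (force simp: compat_def)
    ultimately have "sorted_wrt (compat j) (pl @ [(y, c), (z, c), (x, d)] @ pm)"
      using plm pl pm 2 assms by (auto simp: sorted_wrt_append compat_def)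
    then show ?thesis
      by (rule coverableI[rotated]) (use p 2 in auto)
  next
    \<comment> \<open>The subsequences \<open>c\<close> and \<open>d\<close> exchange their tails.\<close>
    case 3
    have "d \<noteq> c" using p(3) assms 3 by (auto simp: sorted_wrt_append compat_def)
    show ?thesis
    proof (rule coverableI[of "pl @ [(y, d), (z, d), (x, c)] @ map (swap_col c d) pm"])
      show "map fst (pl @ [(y, d), (z, d), (x, c)] @ map (swap_col c d) pm) = L @ [y, z, x] @ M"
        using p by (simp add: comp_def)
      show "m \<le> length (filter (\<lambda>x. snd x < j) (pl @ [(y, d), (z, d), (x, c)] @ map (swap_col c d) pm))"
        using p(4) 3 filter_swap_col[of c j d pm] by simp
      have s: "sorted_wrt (compat j) (map (swap_col c d) pm)"
        by (rule sorted_wrt_swap_col) (use p(3) 3 in \<open>auto simp: sorted_wrt_append\<close>)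
      have pm: "\<forall>q\<in>set pm. compat j (y, d) q \<and> compat j (z, c) q"
        and pl: "\<forall>q\<in>set pl. compat j q (y, d) \<and> compat j q (x, c)"
        and plm: "sorted_wrt (compat j) (pl @ pm)"
        using p(3) 3 by (auto simp: sorted_wrt_append)
      have "\<forall>q\<in>set pl. \<forall>q'\<in>set pm. compat j q (swap_col c d q')"
        by (rule compat_swap_col[OF plm, of _ _ y])
          (use pl pm 3 assms in \<open>fastforce simp: compat_def\<close>)+
      moreover have "\<forall>q\<in>set pl. compat j q (z, d)"
        using pl assms by (force simp: compat_def)
      moreover have "\<forall>q\<in>set pm. compat j (y, d) (swap_col c d q) \<and> compat j (z, d) (swap_col c d q)
          \<and> compat j (x, c) (swap_col c d q)"
        using pm assms 3 by (auto simp: compat_def split: if_splits)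
      ultimately show "sorted_wrt (compat j) (pl @ [(y, d), (z, d), (x, c)] @ map (swap_col c d) pm)"
        using s plm pl \<open>d \<noteq> c\<close> assms
        by (auto simp: sorted_wrt_append compat_def)
    qed
  qed
qed

text \<open>Again only a common colour \<open>c\<close> of \<open>x\<close> and \<open>z\<close>
  obstructs the transposition, and the neighbour \<open>y\<close> resolves it.\<close>

lemma coverable_knuth2:
  assumes "x \<le> y" "y < z"
  shows "coverable j (L @ [z, x, y] @ M) m \<longleftrightarrow> coverable j (L @ [x, z, y] @ M) m"
proof
  assume "coverable j (L @ [z, x, y] @ M) m"
  then obtain pl b c d pm where p: "map fst pl = L" "map fst pm = M"
    "sorted_wrt (compat j) (pl @ [(z, b), (x, c), (y, d)] @ pm)"
    "m \<le> length (filter (\<lambda>x. snd x < j) (pl @ [(z, b), (x, c), (y, d)] @ pm))"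
    by (rule coverableE3)
  show "coverable j (L @ [x, z, y] @ M) m"
    by (rule coverableI[of "pl @ [(x, c), (z, b), (y, d)] @ pm"])
      (use p assms in \<open>auto simp: sorted_wrt_append compat_def\<close>)
next
  assume "coverable j (L @ [x, z, y] @ M) m"
  then obtain pl c b d pm where p: "map fst pl = L" "map fst pm = M"
    "sorted_wrt (compat j) (pl @ [(x, c), (z, b), (y, d)] @ pm)"
    "m \<le> length (filter (\<lambda>x. snd x < j) (pl @ [(x, c), (z, b), (y, d)] @ pm))"
    by (rule coverableE3)
  consider "\<not> (c = b \<and> c < j)" | "c = b" "c < j" "\<not> d < j" | "c = b" "c < j" "d < j" by blast
  then show "coverable j (L @ [z, x, y] @ M) m"
  proof cases
    case 1
    show ?thesis
      by (rule coverableI[of "pl @ [(z, b), (x, c), (y, d)] @ pm"])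
        (use p assms 1 in \<open>auto simp: sorted_wrt_append compat_def\<close>)
  next
    \<comment> \<open>The uncovered \<open>y\<close> takes the place of \<open>z\<close> in the
      subsequence \<open>c\<close>, and \<open>z\<close> becomes uncovered.\<close>
    case 2
    have pm: "\<forall>q\<in>set pm. compat j (z, c) q" and pl: "\<forall>q\<in>set pl. compat j q (x, c)"
      and plm: "sorted_wrt (compat j) (pl @ pm)"
      using p(3) 2 by (auto simp: sorted_wrt_append)
    have "\<forall>q\<in>set pl. compat j q (y, c) \<and> compat j q (z, c) \<and> compat j q (x, d) \<and> compat j q (z, d)"
      using pl 2 assms by (force simp: compat_def)
    moreover have "\<forall>q\<in>set pm. compat j (y, c) q \<and> compat j (x, c) q \<and> compat j (x, d) q \<and> compat j (z, d) q"
      using pm 2 assms by (force simp: compat_def)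
    ultimately have "sorted_wrt (compat j) (pl @ [(z, d), (x, c), (y, c)] @ pm)"
      using plm pl pm 2 assms by (auto simp: sorted_wrt_append compat_def)
    then show ?thesis
      by (rule coverableI[rotated]) (use p 2 in auto)
  next
    \<comment> \<open>Now \<open>z\<close> replaces \<open>y\<close> in the subsequence
      \<open>d\<close>, \<open>y\<close> follows \<open>x\<close> in \<open>c\<close>, and the tails
      of \<open>c\<close> and \<open>d\<close> are exchanged.\<close>
    case 3
    have "d \<noteq> c" using p(3) assms 3 by (auto simp: sorted_wrt_append compat_def)
    show ?thesis
    proof (rule coverableI[of "pl @ [(z, d), (x, c), (y, c)] @ map (swap_col c d) pm"])
      show "map fst (pl @ [(z, d), (x, c), (y, c)] @ map (swap_col c d) pm) = L @ [z, x, y] @ M"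
        using p by (simp add: comp_def)
      show "m \<le> length (filter (\<lambda>x. snd x < j) (pl @ [(z, d), (x, c), (y, c)] @ map (swap_col c d) pm))"
        using p(4) 3 filter_swap_col[of c j d pm] by simp
      have s: "sorted_wrt (compat j) (map (swap_col c d) pm)"
        by (rule sorted_wrt_swap_col) (use p(3) 3 in \<open>auto simp: sorted_wrt_append\<close>)
      have pm: "\<forall>q\<in>set pm. compat j (y, d) q \<and> compat j (z, c) q"
        and pl: "\<forall>q\<in>set pl. compat j q (y, d) \<and> compat j q (x, c)"
        and plm: "sorted_wrt (compat j) (pl @ pm)"
        using p(3) 3 by (auto simp: sorted_wrt_append)
      have "\<forall>q\<in>set pl. \<forall>q'\<in>set pm. compat j q (swap_col c d q')"
        by (rule compat_swap_col[OF plm, of _ _ y])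
          (use pl pm 3 assms in \<open>fastforce simp: compat_def\<close>)+
      moreover have "\<forall>q\<in>set pl. compat j q (z, d) \<and> compat j q (y, c)"
        using pl assms by (force simp: compat_def)
      moreover have "\<forall>q\<in>set pm. compat j (z, d) (swap_col c d q) \<and> compat j (y, c) (swap_col c d q)
          \<and> compat j (x, c) (swap_col c d q)"
        using pm assms 3 by (auto simp: compat_def split: if_splits)
      ultimately show "sorted_wrt (compat j) (pl @ [(z, d), (x, c), (y, c)] @ map (swap_col c d) pm)"
        using s plm pl \<open>d \<noteq> c\<close> assms
        by (auto simp: sorted_wrt_append compat_def)
    qed
  qed
qed

text \<open>First half of a bump as a chain of Knuth moves: the new letter \<open>a\<close> travels
  left over \<open>v\<close> until it stands right behind the letter \<open>b\<close> that it
  replaces.\<close>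

lemma coverable_move_left1:
  assumes "a < b" "sorted (b # v)"
  shows "coverable j (L @ b # v @ a # M) m \<longleftrightarrow> coverable j (L @ b # a # v @ M) m"
  using assms
proof (induction v arbitrary: b L)
  case (Cons x v)
  have "coverable j ((L @ [b]) @ x # v @ a # M) m \<longleftrightarrow> coverable j ((L @ [b]) @ x # a # v @ M) m"
    by (rule Cons.IH) (use Cons.prems in auto)
  also have "\<dots> \<longleftrightarrow> coverable j (L @ b # a # x # v @ M) m"
    using coverable_knuth1[of a b x j L "v @ M" m] Cons.prems by simp
  finally show ?case by simp
qed simp

text \<open>Second half of a bump: \<open>b\<close> travels left over \<open>u\<close> and leaves
  the row at its front, with \<open>a\<close> in its former place.\<close>

lemma coverable_move_left2:
  assumes "a < b" "sorted (u @ [a])"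
  shows "coverable j (L @ u @ b # a # M) m \<longleftrightarrow> coverable j (L @ b # u @ a # M) m"
  using assms
proof (induction u arbitrary: a M rule: rev_induct)
  case (snoc x u)
  have "coverable j (L @ (u @ [x]) @ b # a # M) m \<longleftrightarrow> coverable j (L @ u @ b # x # a # M) m"
    using coverable_knuth2[of x a b j "L @ u" M m] snoc.prems by (simp add: sorted_append)
  also have "\<dots> \<longleftrightarrow> coverable j (L @ b # u @ x # a # M) m"
    by (rule snoc.IH) (use snoc.prems in \<open>auto simp: sorted_append\<close>)
  finally show ?case by simp
qed simp

text \<open>Each bump is a chain of Knuth moves that expels the bumped letter to the left of the
  row. The context \<open>L\<close> absorbs these letters during the induction; \<open>M\<close>
  makes room for rows that are already finished.\<close>

lemma coverable_run:
  assumes "sorted r"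
  shows "coverable j (L @ r @ w @ M) m \<longleftrightarrow>
    coverable j (L @ snd (run (<) r w) @ fst (run (<) r w) @ M) m"
  using assms
proof (induction w arbitrary: r L)
  case (Cons a w)
  have s: "sorted (fst (bump (<) a r))" using Cons.prems by (rule sorted_bump)
  show ?case
  proof (rule bump_cases[of "(<)" a r])
    assume "bump (<) a r = (r @ [a], None)"
    then show ?thesis
      using Cons.IH[of "r @ [a]" L] s by (auto split: prod.splits)
  next
    fix u b v
    assume *: "r = u @ b # v" "bump (<) a r = (u @ a # v, Some b)" "\<forall>x\<in>set u. \<not> a < x" "a < b"
    have "coverable j (L @ r @ (a # w) @ M) m \<longleftrightarrow> coverable j (L @ u @ b # a # v @ w @ M) m"
      using coverable_move_left1[of a b v j "L @ u" "w @ M" m] * Cons.prems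
      by (simp add: sorted_append)
    also have "\<dots> \<longleftrightarrow> coverable j (L @ b # u @ a # v @ w @ M) m"
      using coverable_move_left2[of a b u j L "v @ w @ M" m] * s by (simp add: sorted_append)
    also have "\<dots> \<longleftrightarrow> coverable j ((L @ [b]) @ snd (run (<) (u @ a # v) w) @ fst (run (<) (u @ a # v) w) @ M) m"
      using Cons.IH[of "u @ a # v" "L @ [b]"] s * by simp
    finally show ?thesis
      using *(2) by (auto split: prod.splits)
  qed
qed simp

section \<open>Row reading words of tableaux\<close>

lemma coverable_out_row:
  "coverable j (out (<) w @ row (<) w @ M) m \<longleftrightarrow> coverable j (w @ M) m"
  using coverable_run[of "[]" j "[]" w M m] by (simp add: out_def row_def)

text \<open>The row reading word of the first \<open>h\<close> rows of the insertion tableau, lowest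
  row first.\<close>

definition reading :: "nat \<Rightarrow> 'b :: linorder list \<Rightarrow> 'b list" where
  "reading h w = concat (map (\<lambda>i. row (<) ((out (<) ^^ i) w)) (rev [0..<h]))"

lemma reading_simps [simp]:
  "reading 0 w = []"
  "reading (Suc h) w = row (<) ((out (<) ^^ h) w) @ reading h w"
  by (simp_all add: reading_def)

lemma coverable_reading:
  "coverable j ((out (<) ^^ h) w @ reading h w @ M) m \<longleftrightarrow> coverable j (w @ M) m"
proof (induction h)
  case (Suc h)
  then show ?case
    using coverable_out_row[of j "(out (<) ^^ h) w" "reading h w @ M" m] by simp
qed simp

lemma length_reading: "length (reading j w) + length ((out (<) ^^ j) w) = length w"
proof (induction j)
  case (Suc j)
  then show ?case using length_row_out[of "(<)" "(out (<) ^^ j) w"] by simp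
qed simp

lemma length_reading_sum: "length (reading j w) = (\<Sum>i<j. length (row (<) ((out (<) ^^ i) w)))"
  by (induction j) auto

text \<open>In the reading word the first \<open>j\<close> rows are themselves disjoint increasing
  subsequences, row \<open>i\<close> having colour \<open>i\<close>. The letters pushed below them
  get colour \<open>j\<close> and thus count as uncovered. Knuth invariance carries this cover back
  to \<open>w\<close>.\<close>

lemma coverable_lower: "coverable j w (length w - length ((out (<) ^^ j) w))"
proof -
  have "\<exists>p. map fst p = reading h w \<and> sorted_wrt (compat j) p \<and> (\<forall>x\<in>set p. snd x < h)" for h
  proof (induction h)
    case (Suc h)
    then obtain p where p: "map fst p = reading h w" "sorted_wrt (compat j) p" "\<forall>x\<in>set p. snd x < h"
      by blast
    let ?r = "row (<) ((out (<) ^^ h) w)"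
    have "sorted_wrt (compat j) (map (\<lambda>a. (a, h)) ?r)"
      unfolding sorted_wrt_map
      by (rule sorted_wrt_mono_rel[OF _ sorted_row]) (auto simp: compat_def)
    moreover have "\<forall>x\<in>set (map (\<lambda>a. (a, h)) ?r). \<forall>y\<in>set p. compat j x y"
      using p(3) by (auto simp: compat_def)
    ultimately show ?case
      using p by (intro exI[of _ "map (\<lambda>a. (a, h)) ?r @ p"]) (auto simp: sorted_wrt_append comp_def)
  qed simp
  then obtain p where p: "map fst p = reading j w" "sorted_wrt (compat j) p" "\<forall>x\<in>set p. snd x < j"
    by blast
  let ?o = "map (\<lambda>a. (a, j)) ((out (<) ^^ j) w)"
  have "coverable j ((out (<) ^^ j) w @ reading j w) (length (reading j w))"
  proof (rule coverableI)
    show "map fst (?o @ p) = (out (<) ^^ j) w @ reading j w"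
      using p by (simp add: comp_def)
    have "sorted_wrt (compat j) ?o"
      by (auto simp: sorted_wrt_iff_nth_less compat_def)
    then show "sorted_wrt (compat j) (?o @ p)"
      using p by (auto simp: sorted_wrt_append compat_def)
    have "length p = length (reading j w)" using p(1) by (metis length_map)
    then show "length (reading j w) \<le> length (filter (\<lambda>x. snd x < j) (?o @ p))"
      using p(3) by (simp add: filter_True)
  qed
  then show ?thesis
    using coverable_reading[of j j w "[]"] by (simp flip: length_reading[of j w])
qed

text \<open>The condition for \<open>s\<close> to stand directly below \<open>r\<close> in a
  semistandard tableau.\<close>

definition over :: "'b :: linorder list \<Rightarrow> 'b list \<Rightarrow> bool" where
  "over r s \<longleftrightarrow> length s \<le> length r \<and> (\<forall>c<length s. r ! c < s ! c)"

text \<open>The letters of the upper row only decrease where they change. The bumped letter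
  \<open>b\<close> lands weakly to the left of the column it leaves, since any letter of
  \<open>s\<close> below its old place exceeds it, and up to that column all letters of
  \<open>r'\<close> are smaller than \<open>b\<close>.\<close>

lemma over_bump:
  assumes "over r s" "sorted r" "bump (<) a r = (r', Some b)"
  shows "over r' (fst (bump (<) b s))"
proof -
  obtain u v where r: "r = u @ b # v" "r' = u @ a # v" "\<forall>x\<in>set u. x \<le> a" "a < b"
    using assms(3) by (cases rule: bump_cases[of "(<)" a r]) (auto simp: not_less)
  have le: "r' ! c \<le> r ! c" for c
    using r by (cases "c = length u") (auto simp: nth_append nth_Cons split: nat.splits)
  have lt: "r' ! c < b" if "c \<le> length u" for c
    using that r nth_mem[of c u] by (cases "c = length u") (auto simp: nth_append intro: le_less_trans)
  show ?thesis
  proof (rule bump_cases[of "(<)" b s])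
    assume s: "bump (<) b s = (s @ [b], None)" "\<forall>x\<in>set s. \<not> b < x"
    have "length s \<le> length u"
    proof (rule ccontr)
      assume "\<not> ?thesis"
      then have "r ! length u < s ! length u" "s ! length u \<in> set s"
        using assms(1) by (auto simp: over_def)
      then show False using s(2) r(1) by auto
    qed
    then show ?thesis
      using s(1) assms(1) le lt r unfolding over_def
      by (auto simp: nth_append less_Suc_eq intro: le_less_trans)
  next
    fix u' d v'
    assume s: "s = u' @ d # v'" "bump (<) b s = (u' @ b # v', Some d)" "\<forall>x\<in>set u'. \<not> b < x"
    have "length u' \<le> length u"
    proof (rule ccontr)
      assume "\<not> ?thesis"
      then have "length u < length s" "s ! length u \<in> set u'"
        using s(1) by (auto simp: nth_append)
      moreover from this have "r ! length u < s ! length u"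
        using assms(1) by (simp add: over_def)
      ultimately show False using s(3) r(1) by auto
    qed
    have "r' ! c < (u' @ b # v') ! c" if "c < length s" for c
    proof (cases "c = length u'")
      case True
      then show ?thesis using lt \<open>length u' \<le> length u\<close> by simp
    next
      case False
      then have "(u' @ b # v') ! c = s ! c"
        using s(1) by (auto simp: nth_append nth_Cons split: nat.splits)
      then show ?thesis using le[of c] assms(1) that by (auto simp: over_def intro: le_less_trans)
    qed
    then show ?thesis using s r assms(1) by (auto simp: over_def)
  qed
qed

lemma over_run:
  assumes "over r s" "sorted r"
  shows "over (fst (run (<) r w)) (fst (run (<) s (snd (run (<) r w))))"
  using assms
proof (induction w arbitrary: r s)
  case (Cons a w)
  have s: "sorted (fst (bump (<) a r))" using Cons.prems(2) by (rule sorted_bump)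
  show ?case
  proof (rule bump_cases[of "(<)" a r])
    assume b: "bump (<) a r = (r @ [a], None)"
    have "over (r @ [a]) s" using Cons.prems(1) by (auto simp: over_def nth_append)
    then show ?thesis using Cons.IH[of "r @ [a]" s] s b by (auto split: prod.splits)
  next
    fix u b v assume b: "bump (<) a r = (u @ a # v, Some b)"
    have "over (u @ a # v) (fst (bump (<) b s))"
      using over_bump Cons.prems b by blast
    then show ?thesis
      using Cons.IH[of "u @ a # v" "fst (bump (<) b s)"] s b by (auto split: prod.splits)
  qed
qed simp

lemma over_row: "over (row (<) w) (row (<) (out (<) w))"
  using over_run[of "[]" "[]" w] by (simp add: over_def row_def out_def)

section \<open>Greene's theorem\<close>

lemma length_row_antimono:
  fixes w :: "'b :: linorder list"
  assumes "i \<le> i'"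
  shows "length (row (<) ((out (<) ^^ i') w)) \<le> length (row (<) ((out (<) ^^ i) w))"
  using assms
proof (rule lift_Suc_antimono_le[of "\<lambda>i. length (row (<) ((out (<) ^^ i) w))", rotated])
  show "length (row (<) ((out (<) ^^ Suc i) w)) \<le> length (row (<) ((out (<) ^^ i) w))" for i
    using over_row[of "(out (<) ^^ i) w"] by (simp add: over_def)
qed

lemma row_column_strict:
  fixes w :: "'b :: linorder list"
  assumes "i < i'" "c < length (row (<) ((out (<) ^^ i') w))"
  shows "row (<) ((out (<) ^^ i) w) ! c < row (<) ((out (<) ^^ i') w) ! c"
  using assms
proof (induction i')
  case (Suc i')
  have *: "row (<) ((out (<) ^^ i') w) ! c < row (<) ((out (<) ^^ Suc i') w) ! c"
    "c < length (row (<) ((out (<) ^^ i') w))"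
    using over_row[of "(out (<) ^^ i') w"] Suc.prems by (auto simp: over_def)
  show ?case
  proof (cases "i = i'")
    case False
    then have "row (<) ((out (<) ^^ i) w) ! c < row (<) ((out (<) ^^ i') w) ! c"
      using Suc * by simp
    then show ?thesis using *(1) by (rule less_trans)
  qed (use * in simp)
qed simp

lemma out_pow_eq_Nil: "length w \<le> h \<Longrightarrow> (out lt ^^ h) w = []"
proof (induction h arbitrary: w)
  case (Suc h)
  have "length (out lt w) \<le> h"
    using Suc.prems length_out_less[of w lt] by (cases "w = []") auto
  then show ?case using Suc.IH[of "out lt w"] by (simp only: out_pow_Suc)
qed simp

text \<open>A colouring of the reading word becomes a colouring \<open>\<kappa>\<close> of the cells
  by row and column. Each column is read from bottom to top, hence strictly decreasing, so no colour
  below \<open>j\<close> occurs twice in it. The last conjunct, linking cells to coloured letters,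
  carries the induction.\<close>

lemma coloured_reading:
  assumes "map fst p = reading h w" "sorted_wrt (compat j) p"
  shows "\<exists>\<kappa>. (\<forall>i'<h. \<forall>i<i'. \<forall>c<length (row (<) ((out (<) ^^ i') w)). \<kappa> i' c = \<kappa> i c \<longrightarrow> \<not> \<kappa> i c < j) \<and>
    length (filter (\<lambda>x. snd x < j) p) =
      (\<Sum>i<h. card {c. c < length (row (<) ((out (<) ^^ i) w)) \<and> \<kappa> i c < j}) \<and>
    (\<forall>i<h. \<forall>c<length (row (<) ((out (<) ^^ i) w)). (row (<) ((out (<) ^^ i) w) ! c, \<kappa> i c) \<in> set p)"
  using assms
proof (induction h arbitrary: p)
  case (Suc h)
  define r where "r = (\<lambda>i. row (<) ((out (<) ^^ i) w))"
  from Suc.prems(1) obtain p1 p2 where p: "p = p1 @ p2" "map fst p1 = r h" "map fst p2 = reading h w"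
    by (auto simp: map_eq_append_conv r_def)
  have "sorted_wrt (compat j) p2" using Suc.prems(2) p(1) by (simp add: sorted_wrt_append)
  from Suc.IH[OF p(3) this] obtain \<kappa> where
    k1: "\<forall>i'<h. \<forall>i<i'. \<forall>c<length (r i'). \<kappa> i' c = \<kappa> i c \<longrightarrow> \<not> \<kappa> i c < j" and
    k2: "length (filter (\<lambda>x. snd x < j) p2) = (\<Sum>i<h. card {c. c < length (r i) \<and> \<kappa> i c < j})" and
    k3: "\<forall>i<h. \<forall>c<length (r i). (r i ! c, \<kappa> i c) \<in> set p2"
    unfolding r_def by blast
  define \<kappa>' where "\<kappa>' = \<kappa>(h := \<lambda>c. snd (p1 ! c))"
  have len: "length p1 = length (r h)" using p(2) by (metis length_map)
  have p1: "(r h ! c, \<kappa>' h c) = p1 ! c" if "c < length (r h)" for c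
    using that p(2) len by (metis \<kappa>'_def fun_upd_same nth_map prod.collapse)
  have k3': "\<forall>i<Suc h. \<forall>c<length (r i). (r i ! c, \<kappa>' i c) \<in> set p"
    using k3 p(1) p1 len by (auto simp: less_Suc_eq \<kappa>'_def)
  have "\<not> \<kappa>' i c < j" if "i < h" "c < length (r h)" "\<kappa>' h c = \<kappa>' i c" for i c
  proof
    assume "\<kappa>' i c < j"
    have "c < length (r i)"
      using that(1,2) length_row_antimono[of i h w] by (simp add: r_def)
    then have "(r i ! c, \<kappa>' i c) \<in> set p2" using k3 that(1) by (simp add: \<kappa>'_def)
    moreover have "(r h ! c, \<kappa>' h c) \<in> set p1" using p1[OF that(2)] that(2) len by simp
    ultimately have "compat j (r h ! c, \<kappa>' h c) (r i ! c, \<kappa>' i c)"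
      using Suc.prems(2) p(1) by (simp add: sorted_wrt_append)
    then have "r h ! c \<le> r i ! c"
      using that(3) \<open>\<kappa>' i c < j\<close> by (simp add: compat_def)
    then show False
      using row_column_strict[of i h c w] that by (simp add: r_def)
  qed
  then have k1': "\<forall>i'<Suc h. \<forall>i<i'. \<forall>c<length (r i'). \<kappa>' i' c = \<kappa>' i c \<longrightarrow> \<not> \<kappa>' i c < j"
    using k1 by (auto simp: less_Suc_eq \<kappa>'_def)
  have "length (filter (\<lambda>x. snd x < j) p1) = card {c. c < length (r h) \<and> \<kappa>' h c < j}"
    unfolding length_filter_conv_card using len by (simp add: \<kappa>'_def)
  then have "length (filter (\<lambda>x. snd x < j) p) =
      (\<Sum>i<Suc h. card {c. c < length (r i) \<and> \<kappa>' i c < j})"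
    using k2 p(1) by (simp add: \<kappa>'_def)
  then show ?case using k1' k3' unfolding r_def by blast
qed simp

text \<open>Cells are counted by columns. A column reaching through the first \<open>j\<close> rows
  has at most \<open>j\<close> coloured cells, because their colours differ; a shorter column lies
  entirely within these rows.\<close>

lemma card_cells_le:
  fixes l :: "nat \<Rightarrow> nat" and \<kappa> :: "nat \<Rightarrow> nat \<Rightarrow> nat"
  assumes "antimono l" "j \<le> h"
    and "\<forall>i'<h. \<forall>i<i'. \<forall>c<l i'. \<kappa> i' c = \<kappa> i c \<longrightarrow> \<not> \<kappa> i c < j"
  shows "(\<Sum>i<h. card {c. c < l i \<and> \<kappa> i c < j}) \<le> (\<Sum>i<j. l i)"
proof -
  have l0: "l i \<le> l 0" for i using assms(1) by (simp add: antimonoD)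
  have row_sum: "card {c. c < l i \<and> Q c} = (\<Sum>c<l 0. of_bool (c < l i \<and> Q c))" for i Q
  proof -
    have "{c. c < l i \<and> Q c} = {c\<in>{..<l 0}. c < l i \<and> Q c}"
      using l0[of i] by (auto intro: less_le_trans)
    then show ?thesis by (simp add: sum.If_cases of_bool_def Int_def)
  qed
  have col: "card {i\<in>{..<h}. c < l i \<and> \<kappa> i c < j} \<le> card {i\<in>{..<j}. c < l i}" for c
  proof (cases "\<forall>i<j. c < l i")
    case True
    have "inj_on (\<lambda>i. \<kappa> i c) {i\<in>{..<h}. c < l i \<and> \<kappa> i c < j}"
    proof (rule inj_onI, rule ccontr)
      fix a b
      assume *: "a \<in> {i\<in>{..<h}. c < l i \<and> \<kappa> i c < j}" "b \<in> {i\<in>{..<h}. c < l i \<and> \<kappa> i c < j}"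
        "\<kappa> a c = \<kappa> b c" "a \<noteq> b"
      then consider "a < b" | "b < a" by linarith
      then show False
      proof cases
        case 1
        then show ?thesis using assms(3)[rule_format, of b a c] * by simp
      next
        case 2
        then show ?thesis using assms(3)[rule_format, of a b c] * by simp
      qed
    qed
    then have "card {i\<in>{..<h}. c < l i \<and> \<kappa> i c < j} \<le> card {..<j}"
      by (rule card_inj_on_le) auto
    also have "{..<j} = {i\<in>{..<j}. c < l i}" using True by auto
    finally show ?thesis .
  next
    case False
    then obtain i0 where "i0 < j" "l i0 \<le> c" by (auto simp: not_less)
    have "i < j" if "c < l i" for i
    proof (rule ccontr)
      assume "\<not> i < j"
      then have "l i \<le> l i0" using assms(1) \<open>i0 < j\<close> by (simp add: antimonoD)
      then show False using that \<open>l i0 \<le> c\<close> by simp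
    qed
    then show ?thesis by (intro card_mono) auto
  qed
  have "(\<Sum>i<h. card {c. c < l i \<and> \<kappa> i c < j})
      = (\<Sum>i<h. \<Sum>c<l 0. of_bool (c < l i \<and> \<kappa> i c < j))"
    by (simp only: row_sum)
  also have "\<dots> = (\<Sum>c<l 0. \<Sum>i<h. of_bool (c < l i \<and> \<kappa> i c < j))"
    by (rule sum.swap)
  also have "\<dots> = (\<Sum>c<l 0. card {i\<in>{..<h}. c < l i \<and> \<kappa> i c < j})"
    by (simp add: of_bool_def sum.If_cases Int_def)
  also have "\<dots> \<le> (\<Sum>c<l 0. card {i\<in>{..<j}. c < l i})"
    by (intro sum_mono col)
  also have "\<dots> = (\<Sum>c<l 0. \<Sum>i<j. of_bool (c < l i))"
    by (simp add: of_bool_def sum.If_cases Int_def)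
  also have "\<dots> = (\<Sum>i<j. \<Sum>c<l 0. of_bool (c < l i))"
    by (rule sum.swap)
  also have "\<dots> = (\<Sum>i<j. l i)"
    using row_sum[of _ "\<lambda>_. True"] by simp
  finally show ?thesis .
qed

text \<open>The cover is moved to the reading word of the whole tableau and counted there. Together
  with \<open>coverable_lower\<close> this is Greene's theorem.\<close>

lemma coverable_upper:
  assumes "coverable j w m"
  shows "m \<le> length w - length ((out (<) ^^ j) w)"
proof -
  \<comment> \<open>With \<open>length w\<close> rows the tableau is exhausted, and
    \<open>j \<le> h\<close> is what the count by columns requires.\<close>
  define h where "h = max j (length w)"
  have "coverable j (reading h w) m"
    using coverable_reading[of j h w "[]" m] out_pow_eq_Nil[of w h "(<)"] assms
    by (simp add: h_def)
  then obtain p where p: "map fst p = reading h w" "sorted_wrt (compat j) p"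
     "m \<le> length (filter (\<lambda>x. snd x < j) p)"
    unfolding coverable_def by blast
  define l where "l = (\<lambda>i. length (row (<) ((out (<) ^^ i) w)))"
  from coloured_reading[OF p(1,2)] obtain \<kappa> where
    "\<forall>i'<h. \<forall>i<i'. \<forall>c<l i'. \<kappa> i' c = \<kappa> i c \<longrightarrow> \<not> \<kappa> i c < j"
    "length (filter (\<lambda>x. snd x < j) p) = (\<Sum>i<h. card {c. c < l i \<and> \<kappa> i c < j})"
    unfolding l_def by blast
  moreover have "antimono l" unfolding l_def by (intro antimonoI length_row_antimono)
  ultimately have "m \<le> (\<Sum>i<j. l i)"
    using card_cells_le[of l j h \<kappa>] p(3) by (simp add: h_def)
  then show ?thesis
    using length_reading[of j w] by (simp add: l_def flip: length_reading_sum)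
qed

section \<open>Comparing shapes through Greene's theorem\<close>

lemma length_out_pow_cong:
  fixes w w' :: "'b :: linorder list"
  assumes "\<And>m. coverable j w m \<longleftrightarrow> coverable j w' m" "length w = length w'"
  shows "length ((out (<) ^^ j) w) = length ((out (<) ^^ j) w')"
proof -
  have "length w - length ((out (<) ^^ j) w) = length w' - length ((out (<) ^^ j) w')"
    using coverable_lower[of j w] coverable_upper[of j w'] coverable_lower[of j w'] coverable_upper[of j w] assms(1)
    by (meson le_antisym)
  then show ?thesis
    using length_out_pow_le[of j "(<)" w] length_out_pow_le[of j "(<)" w'] assms(2) by simp
qed

text \<open>Knuth equivalent words have the same shape. A filler block turns \<open>w\<close> into
  exactly this rearrangement one row further down.\<close>

lemma length_out_pow_out_row:
  fixes w :: "'b :: linorder list"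
  shows "length ((out (<) ^^ j) (out (<) w @ row (<) w)) = length ((out (<) ^^ j) w)"
  using coverable_out_row[of j w "[]"] length_row_out[of "(<)" w]
  by (intro length_out_pow_cong) auto

text \<open>Restricting an optimal cover of \<open>w\<close> loses at most as many covered letters
  as are deleted, so the number of uncovered letters does not grow.\<close>

lemma length_out_pow_filter:
  fixes w :: "'b :: linorder list"
  shows "length ((out (<) ^^ j) (filter P w)) \<le> length ((out (<) ^^ j) w)"
proof -
  define m where "m = length w - length ((out (<) ^^ j) w)"
  have "coverable j w m" unfolding m_def by (rule coverable_lower)
  then obtain p where p: "map fst p = w" "sorted_wrt (compat j) p"
     "m \<le> length (filter (\<lambda>x. snd x < j) p)"
    unfolding coverable_def by blast
  define q where "q = filter (\<lambda>x. P (fst x)) p"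
  have q: "map fst q = filter P w" using p(1) by (auto simp: q_def filter_map comp_def)
  have "length (filter (\<lambda>x. snd x < j) p) \<le> length (filter (\<lambda>x. snd x < j) q) + length (filter (\<lambda>x. \<not> P (fst x)) p)"
    unfolding q_def by (induction p) auto
  moreover have "length (filter (\<lambda>x. \<not> P (fst x)) p) + length q = length p"
    unfolding q_def using sum_length_filter_compl[of "\<lambda>x. P (fst x)" p] by simp
  moreover have "length p = length w" "length q = length (filter P w)"
    using p(1) q by (metis length_map)+
  ultimately have "m \<le> length (filter (\<lambda>x. snd x < j) q) + (length w - length (filter P w))"
    using p(3) by simp
  moreover have "length (filter (\<lambda>x. snd x < j) q) \<le> length (filter P w) - length ((out (<) ^^ j) (filter P w))"
    by (rule coverable_upper, rule coverableI[OF q])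
      (use p(2) in \<open>auto simp: q_def sorted_wrt_filter\<close>)
  ultimately show ?thesis
    using length_out_pow_le[of j "(<)" "filter P w"] length_out_pow_le[of j "(<)" w] length_filter_le[of P w]
    unfolding m_def by linarith
qed

section \<open>Fillers\<close>

lemma bump_append:
  assumes "\<forall>x\<in>set u. \<not> lt a x"
  shows "bump lt a (u @ r) = (u @ fst (bump lt a r), snd (bump lt a r))"
  using assms by (induction u) (auto split: prod.splits)

text \<open>The copies of \<open>z\<close> expel the letters of \<open>r\<close> from left to right,
  so \<open>r\<close> itself is the bumped word; \<open>m\<close> counts the copies already in the
  row.\<close>

lemma run_replicate:
  assumes "\<forall>x\<in>set r. z < x" "length r \<le> n"
  shows "run (<) (replicate m z @ r) (replicate n (z :: 'b :: linorder)) = (replicate (m + n) z, r)"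
  using assms
proof (induction n arbitrary: m r)
  case (Suc n)
  show ?case
  proof (cases r)
    case Nil
    have "bump (<) z (replicate m z @ []) = (replicate m z @ [z], None)"
      by (subst bump_append) auto
    moreover have "replicate m z @ [z] = replicate (Suc m) z"
      by (simp add: replicate_append_same)
    ultimately show ?thesis
      using Suc.IH[of "[]" "Suc m"] Nil by simp
  next
    case (Cons c r')
    have "bump (<) z (replicate m z @ r) = (replicate m z @ z # r', Some c)"
      using Cons Suc.prems by (subst bump_append) auto
    moreover have "replicate m z @ z # r' = replicate (Suc m) z @ r'"
      by (simp add: replicate_app_Cons_same)
    ultimately show ?thesis
      using Suc.IH[of r' "Suc m"] Cons Suc.prems by simp
  qed
qed simp

definition blocks :: "nat \<Rightarrow> 'b list \<Rightarrow> 'b list" where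
  "blocks n vs = concat (map (replicate n) vs)"

lemma blocks_simps [simp]: "blocks n [] = []" "blocks n (v # vs) = replicate n v @ blocks n vs"
  by (simp_all add: blocks_def)

lemma set_blocks: "set (blocks n vs) \<subseteq> set vs"
  by (induction vs) auto

lemma map_blocks: "map g (blocks n vs) = blocks n (map g vs)"
  by (induction vs) auto

text \<open>Every block expels the whole preceding block, which has the same length and a larger
  letter; only the last block stays in the row.\<close>

lemma run_blocks:
  assumes "sorted_wrt (>) (v # vs)"
  shows "snd (run (<) (replicate n (v :: 'b :: linorder)) (blocks n vs)) = blocks n (butlast (v # vs))"
  using assms
proof (induction vs arbitrary: v)
  case (Cons x vs)
  have "run (<) (replicate n v) (replicate n x) = (replicate n x, replicate n v)"
    using run_replicate[of "replicate n v" x n 0] Cons.prems by auto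
  then show ?case
    using Cons by (simp add: run_append)
qed simp

text \<open>The first block expels the row of \<open>w\<close>. What reaches the next row is
  \<open>out (<) w\<close> followed by \<open>row (<) w\<close>, equivalent to \<open>w\<close>, and
  then the filler without its last block. Induction shows that a filler of small letters pushes the
  tableau down by one row per block.\<close>

lemma length_out_pow_blocks:
  fixes w :: "'b :: linorder list"
  assumes "sorted_wrt (>) vs" "\<forall>x\<in>set w. \<forall>v\<in>set vs. v < x" "length w \<le> n"
  shows "length ((out (<) ^^ (length vs + e)) (w @ blocks n vs)) = length ((out (<) ^^ e) w)"
  using assms
proof (induction "length vs" arbitrary: vs w)
  case (Suc l)
  then obtain v vs' where vs: "vs = v # vs'" by (cases vs) auto
  have row: "set (row (<) w) \<union> set (out (<) w) = set w" by (rule set_row_out)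
  have "run (<) (row (<) w) (replicate n v) = (replicate n v, row (<) w)"
    using run_replicate[of "row (<) w" v n 0] Suc.prems vs row length_row_out[of "(<)" w] by auto
  then have "out (<) (w @ blocks n vs) = (out (<) w @ row (<) w) @ blocks n (butlast vs)"
    using run_blocks[of v vs' n] Suc.prems(1) unfolding vs by (simp add: out_append run_append)
  moreover have "length ((out (<) ^^ (length (butlast vs) + e)) ((out (<) w @ row (<) w) @ blocks n (butlast vs)))
      = length ((out (<) ^^ e) (out (<) w @ row (<) w))"
  proof (rule Suc.hyps(1))
    show "l = length (butlast vs)" using Suc.hyps(2) by simp
    show "sorted_wrt (>) (butlast vs)"
      using Suc.prems(1) by (simp add: butlast_conv_take sorted_wrt_take)
    show "\<forall>x\<in>set (out (<) w @ row (<) w). \<forall>v\<in>set (butlast vs). v < x"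
      using Suc.prems(2) row in_set_butlastD[of _ vs] by auto
    show "length (out (<) w @ row (<) w) \<le> n"
      using Suc.prems(3) length_row_out[of "(<)" w] by simp
  qed
  moreover have "length vs + e = Suc (length (butlast vs) + e)" using vs by simp
  ultimately show ?case
    by (simp only: out_pow_Suc length_out_pow_out_row)
qed simp

text \<open>Letters above \<open>y\<close> never influence where letters up to \<open>y\<close>
  go.\<close>

lemma run_filter_le:
  fixes w :: "'b :: linorder list"
  assumes "sorted r"
  shows "run (<) (filter (\<lambda>x. x \<le> y) r) (filter (\<lambda>x. x \<le> y) w) =
    map_prod (filter (\<lambda>x. x \<le> y)) (filter (\<lambda>x. x \<le> y)) (run (<) r w)"
  using assms
proof (induction w arbitrary: r)
  case (Cons a w)
  have s: "sorted (fst (bump (<) a r))" using Cons.prems by (rule sorted_bump)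
  show ?case
  proof (rule bump_cases[of "(<)" a r])
    assume b: "bump (<) a r = (r @ [a], None)" "\<forall>x\<in>set r. \<not> a < x"
    have "bump (<) a (filter (\<lambda>x. x \<le> y) r) = (filter (\<lambda>x. x \<le> y) r @ [a], None)"
      using bump_append[of "filter (\<lambda>x. x \<le> y) r" "(<)" a "[]"] b(2) by simp
    then show ?thesis
      using Cons.IH[of "r @ [a]"] s b(1) by (auto split: prod.splits)
  next
    fix u b v
    assume b: "r = u @ b # v" "bump (<) a r = (u @ a # v, Some b)" "\<forall>x\<in>set u. \<not> a < x" "a < b"
    \<comment> \<open>If the replaced letter exceeds \<open>y\<close>, so does everything behind it
      in the row; after restriction, \<open>a\<close> is simply appended.\<close>
    have v: "filter (\<lambda>x. x \<le> y) v = []" if "\<not> b \<le> y"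
      using that Cons.prems b(1) by (auto simp: sorted_append filter_empty_conv)
    have "bump (<) a (filter (\<lambda>x. x \<le> y) r) = (filter (\<lambda>x. x \<le> y) (u @ a # v), if b \<le> y then Some b else None)"
      if "a \<le> y"
      using bump_append[of "filter (\<lambda>x. x \<le> y) u" "(<)" a "filter (\<lambda>x. x \<le> y) (b # v)"] b v that
      by auto
    then show ?thesis
      using Cons.IH[of "u @ a # v"] s b v by (auto split: prod.splits)
  qed
qed simp

lemma out_pow_filter_le:
  fixes w :: "'b :: linorder list"
  shows "(out (<) ^^ i) (filter (\<lambda>x. x \<le> y) w) = filter (\<lambda>x. x \<le> y) ((out (<) ^^ i) w)"
proof (induction i)
  case (Suc i)
  have "out (<) (filter (\<lambda>x. x \<le> y) ((out (<) ^^ i) w)) = filter (\<lambda>x. x \<le> y) (out (<) ((out (<) ^^ i) w))"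
    using run_filter_le[of "[]" y "(out (<) ^^ i) w"] by (simp add: out_def)
  then show ?case using Suc by simp
qed simp

lemma row_filter_le:
  fixes w :: "'b :: linorder list"
  shows "row (<) (filter (\<lambda>x. x \<le> y) w) = filter (\<lambda>x. x \<le> y) (row (<) w)"
  using run_filter_le[of "[]" y w] by (simp add: row_def)

section \<open>Words of distinct letters\<close>

lemma distinct_row_out:
  assumes "distinct w"
  shows "distinct (row lt w @ out lt w)"
proof (rule card_distinct)
  show "card (set (row lt w @ out lt w)) = length (row lt w @ out lt w)"
    using set_row_out[of lt w] length_row_out[of lt w] distinct_card[OF assms] by simp
qed

lemma distinct_out_pow: "distinct w \<Longrightarrow> distinct ((out lt ^^ j) w)"
proof (induction j)
  case (Suc j)
  then show ?case using distinct_row_out[of "(out lt ^^ j) w" lt] by simp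
qed simp

text \<open>With distinct letters, a member of the \<open>k\<close>th bumped word has left the first
  \<open>k\<close> rows for good.\<close>

lemma row_out_pow_disjoint:
  assumes "distinct w" "i < k"
  shows "set (row lt ((out lt ^^ i) w)) \<inter> set ((out lt ^^ k) w) = {}"
proof -
  have "(out lt ^^ k) w = (out lt ^^ (k - Suc i)) ((out lt ^^ Suc i) w)"
    using assms(2) by (metis Suc_leI add.commute comp_apply funpow_add le_add_diff_inverse)
  then have "set ((out lt ^^ k) w) \<subseteq> set (out lt ((out lt ^^ i) w))"
    using set_out_pow[of "k - Suc i" lt "(out lt ^^ Suc i) w"] by simp
  then show ?thesis
    using distinct_row_out[OF distinct_out_pow[OF assms(1), of i lt]] by auto
qed

text \<open>A bumped letter exceeds the one that bumps it. Each row therefore raises a lower bound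
  by one, and \<open>k\<close> rows lift it past the \<open>k\<close> values of a filler.\<close>

lemma bumped_gt:
  fixes w :: "nat list"
  assumes "\<forall>x\<in>set w. m \<le> x"
  shows "\<forall>y\<in>set (snd (run (<) r w)). Suc m \<le> y"
  using assms
proof (induction w arbitrary: r)
  case (Cons a w)
  have "\<forall>b\<in>set_option (snd (bump (<) a r)). a < b"
    by (rule bump_cases[of "(<)" a r]) auto
  then show ?case
    using Cons.IH[of "fst (bump (<) a r)"] Cons.prems by (auto split: prod.splits option.splits)
qed simp

text \<open>The map \<open>g\<close> fixes the rows that \<open>u\<close> has built and preserves
  order on all letters met by \<open>X\<close>, so every bumping decision in the first
  \<open>j\<close> rows is the same for \<open>X\<close> and for its image.\<close>

lemma out_pow_relabel:
  fixes u X :: "nat list"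
  assumes "strict_mono_on A g"
    and "\<forall>i<j. \<forall>a\<in>set (row (<) ((out (<) ^^ i) u)). a \<in> A \<and> g a = a"
    and "set X \<subseteq> A" "\<forall>x\<in>set X. m \<le> x"
  shows "\<exists>Y. (out (<) ^^ j) (u @ X) = (out (<) ^^ j) u @ Y \<and>
    (out (<) ^^ j) (u @ map g X) = (out (<) ^^ j) u @ map g Y \<and> set Y \<subseteq> A \<and> (\<forall>y\<in>set Y. m + j \<le> y)"
  using assms(2-)
proof (induction j arbitrary: u X m)
  case (Suc j)
  let ?r = "row (<) u"
  obtain R Y where Y: "run (<) ?r X = (R, Y)" by fastforce
  have r: "\<forall>a\<in>set ?r. a \<in> A \<and> g a = a" using Suc.prems(1) by (metis funpow_0 zero_less_Suc)
  then have gr: "map g ?r = ?r" by (simp add: map_idI)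
  have "\<forall>a\<in>A. \<forall>b\<in>A. g a < g b \<longleftrightarrow> a < b"
    using assms(1) by (simp add: strict_mono_on_less)
  then have "run (<) (map g ?r) (map g X) = map_prod (map g) (map g) (run (<) ?r X)"
    by (rule run_map) (use r Suc.prems(2) in auto)
  then have gY: "snd (run (<) ?r (map g X)) = map g Y" using Y gr by simp
  have "set Y \<subseteq> A"
    using set_run[of "(<)" ?r X] Y r Suc.prems(2) by auto
  moreover have "\<forall>y\<in>set Y. Suc m \<le> y"
    using bumped_gt[of X m ?r] Suc.prems(3) Y by auto
  moreover have "\<forall>i<j. \<forall>a\<in>set (row (<) ((out (<) ^^ i) (out (<) u))). a \<in> A \<and> g a = a"
    using Suc.prems(1) by (metis Suc_less_eq out_pow_Suc)
  ultimately obtain Z where "(out (<) ^^ j) (out (<) u @ Y) = (out (<) ^^ j) (out (<) u) @ Z"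
    "(out (<) ^^ j) (out (<) u @ map g Y) = (out (<) ^^ j) (out (<) u) @ map g Z"
    "set Z \<subseteq> A" "\<forall>y\<in>set Z. Suc m + j \<le> y"
    using Suc.IH[of "out (<) u" Y "Suc m"] by blast
  then show ?case
    using Y gY by (intro exI[of _ Z]) (simp add: out_pow_Suc out_append del: funpow.simps)
qed simp

section \<open>The inequality for distinct numbers\<close>

definition levels :: "nat \<Rightarrow> nat \<Rightarrow> nat list" where
  "levels \<theta> k = map (\<lambda>i. \<theta> + i) (rev [1..<Suc k])"

lemma levels: "length (levels \<theta> k) = k" "set (levels \<theta> k) = {\<theta><..\<theta> + k}" "sorted_wrt (>) (levels \<theta> k)"
proof -
  show "set (levels \<theta> k) = {\<theta><..\<theta> + k}"
  proof (intro set_eqI iffI)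
    fix x assume "x \<in> {\<theta><..\<theta> + k}"
    then have "x = \<theta> + (x - \<theta>)" "x - \<theta> \<in> {1..<Suc k}" by auto
    then show "x \<in> set (levels \<theta> k)" unfolding levels_def by (metis image_eqI set_map set_rev set_upt)
  qed (auto simp: levels_def)
  show "sorted_wrt (>) (levels \<theta> k)"
    by (simp add: levels_def sorted_wrt_map sorted_wrt_rev sorted_wrt_upt del: upt_Suc)
qed (simp add: levels_def)

lemma length_out_pow_restrict_bumped:
  fixes w :: "nat list"
  assumes "distinct w" and mult: "\<forall>a\<in>set w. Suc k dvd a \<and> 0 < a"
  defines "S \<equiv> set ((out (<) ^^ k) w)"
  shows "length ((out (<) ^^ e) (filter (\<lambda>a. a \<in> S) w)) \<le> length ((out (<) ^^ (k + e)) w)"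
proof -
  define n where "n = length w"
  define v where "v = (\<lambda>q. filter (\<lambda>a. a \<le> Suc k * q \<or> a \<in> S) w)"
  define X where "X = (\<lambda>q. blocks n (levels (Suc k * q) k))"
  \<comment> \<open>The letters being multiples of \<open>k + 1\<close> leaves \<open>k\<close> free values above each of them for the filler.\<close>
  have multE: "\<exists>t. a = Suc k * t" if "a \<in> set w" for a
    using mult that by (blast elim: dvdE)
  have X: "set (X q) \<subseteq> {Suc k * q<..Suc k * q + k}" for q
    using set_blocks[of n "levels (Suc k * q) k"] levels(2) by (simp add: X_def)
  have "length ((out (<) ^^ (k + e)) (v q @ X q)) \<le> length ((out (<) ^^ (k + e)) (v (Suc q) @ X (Suc q)))" for q
  proof -
    define \<theta> where "\<theta> = Suc k * q"
    have \<theta>: "Suc k * Suc q = \<theta> + Suc k" by (simp add: \<theta>_def)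
    let ?y = "\<theta> + Suc k"
    \<comment> \<open>The set omits \<open>?y\<close> and the \<open>k\<close> values directly above
      it. Hence \<open>g\<close>, which lifts the filler values from below \<open>?y\<close> into
      this gap, is strictly increasing on it.\<close>
    let ?A = "{a. a \<le> \<theta> + k \<or> \<theta> + 2 * k + 1 < a}"
    define g where "g = (\<lambda>a. if \<theta> < a \<and> a \<le> \<theta> + k then a + Suc k else a)"
    have mono: "strict_mono_on ?A g" by (auto simp: strict_mono_on_def g_def)
    have gX: "X (Suc q) = map g (X q)"
      unfolding X_def map_blocks \<theta> \<theta>_def[symmetric]
      by (rule arg_cong[where f = "blocks n"]) (auto simp: levels_def g_def)
    have fixed_rows: "a \<in> ?A \<and> g a = a" if "i < k" "a \<in> set (row (<) ((out (<) ^^ i) (v q)))" for i a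
    proof -
      have v: "a \<in> set (v q)" using that(2) set_row_out set_out_pow by fast
      have "a \<noteq> ?y"
      proof
        assume a: "a = ?y"
        then have "a \<in> S" using v \<theta> by (auto simp: v_def \<theta>_def)
        \<comment> \<open>As \<open>?y\<close> is in \<open>S\<close>, the words \<open>v q\<close>
          and \<open>w\<close> have the same letters up to \<open>?y\<close>, so \<open>?y\<close>
          would lie in row \<open>i\<close> for \<open>w\<close> too, although it was bumped below
          row \<open>k\<close>.\<close>
        have "filter (\<lambda>x. x \<le> a) (v q) = filter (\<lambda>x. x \<le> a) w"
        proof -
          have "x \<le> \<theta> \<or> x \<in> S" if "x \<in> set w" "x \<le> a" for x
          proof (cases "x = a")
            case False
            obtain t where t: "x = Suc k * t" using multE[OF \<open>x \<in> set w\<close>] by blast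
            have "Suc k * t < Suc k * Suc q" using False that(2) a t \<theta> by simp
            then have "t < Suc q" by (simp only: mult_less_cancel1)
            then have "Suc k * t \<le> Suc k * q" by (intro mult_le_mono2) simp
            then show ?thesis unfolding \<theta>_def t by blast
          qed (use \<open>a \<in> S\<close> in simp)
          then show ?thesis unfolding v_def \<theta>_def[symmetric] filter_filter
            by (intro filter_cong) auto
        qed
        moreover have "a \<in> set (row (<) ((out (<) ^^ i) (filter (\<lambda>x. x \<le> a) (v q))))"
          using that(2) by (simp add: out_pow_filter_le row_filter_le)
        ultimately have "a \<in> set (row (<) ((out (<) ^^ i) w))"
          by (simp add: out_pow_filter_le row_filter_le)
        then show False
          using row_out_pow_disjoint[OF assms(1) that(1), of "(<)"] \<open>a \<in> S\<close> by (auto simp: S_def)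
      qed
      \<comment> \<open>A multiple of \<open>k + 1\<close> other than \<open>?y\<close> is at most
        \<open>\<theta>\<close> or at least \<open>\<theta> + 2 * k + 2\<close>, hence in the domain
        and not moved by \<open>g\<close>.\<close>
      obtain t where t: "a = Suc k * t" using multE[of a] v by (auto simp only: v_def set_filter mem_Collect_eq)
      have "t \<le> q \<or> q + 2 \<le> t" using \<open>a \<noteq> ?y\<close> t \<theta> by (metis Suc_leI add_2_eq_Suc' le_less_linear le_neq_implies_less)
      then have "Suc k * t \<le> Suc k * q \<or> Suc k * (q + 2) \<le> Suc k * t" using mult_le_mono2 by blast
      moreover have "Suc k * (q + 2) = \<theta> + 2 * k + 2" by (simp add: \<theta>_def)
      ultimately have "a \<le> \<theta> \<or> \<theta> + 2 * k + 2 \<le> a" by (metis t \<theta>_def)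
      then show ?thesis by (auto simp: g_def)
    qed
    obtain Y where Y: "(out (<) ^^ k) (v q @ X q) = (out (<) ^^ k) (v q) @ Y"
      "(out (<) ^^ k) (v q @ map g (X q)) = (out (<) ^^ k) (v q) @ map g Y"
      "set Y \<subseteq> ?A" "\<forall>y\<in>set Y. \<theta> + 1 + k \<le> y"
      using out_pow_relabel[OF mono, of k "v q" "X q" "\<theta> + 1"] fixed_rows X[of q]
      unfolding \<theta>_def[symmetric] by fastforce
    \<comment> \<open>Whatever emerges below row \<open>k\<close> exceeds
      \<open>\<theta> + k\<close>, beyond the values moved by \<open>g\<close>; both fillers thus
      give the same \<open>k\<close>th bumped word.\<close>
    have "map g Y = Y" using Y(3,4) by (intro map_idI) (auto simp: g_def)
    then have "(out (<) ^^ k) (v q @ X q) = (out (<) ^^ k) (v q @ X (Suc q))"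
      using Y gX by simp
    then have "length ((out (<) ^^ (k + e)) (v q @ X q)) = length ((out (<) ^^ (k + e)) (v q @ X (Suc q)))"
      by (simp add: funpow_add add.commute[of k e])
    \<comment> \<open>The step from \<open>q\<close> to \<open>q + 1\<close> can only add the letter
      \<open>?y\<close>, and adds nothing if \<open>?y\<close> is in \<open>S\<close> or absent from
      \<open>w\<close>.\<close>
    moreover have "v q @ X (Suc q) = filter (\<lambda>a. a \<noteq> ?y \<or> a \<in> S) (v (Suc q) @ X (Suc q))"
    proof -
      have "filter (\<lambda>a. a \<noteq> ?y \<or> a \<in> S) (X (Suc q)) = X (Suc q)"
        using X[of "Suc q"] \<theta> by (intro filter_True) auto
      moreover have "filter (\<lambda>a. a \<noteq> ?y \<or> a \<in> S) (v (Suc q)) = v q"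
      proof -
        have "(a \<le> \<theta> + Suc k \<or> a \<in> S) \<and> (a \<noteq> ?y \<or> a \<in> S) \<longleftrightarrow> a \<le> \<theta> \<or> a \<in> S" if "a \<in> set w" for a
        proof -
          obtain t where t: "a = Suc k * t" using multE[OF \<open>a \<in> set w\<close>] by blast
          have "a \<le> \<theta>" if "a < ?y"
          proof -
            have "Suc k * t < Suc k * Suc q" using that t \<theta> by simp
            then have "t < Suc q" by (simp only: mult_less_cancel1)
            then have "Suc k * t \<le> Suc k * q" by (intro mult_le_mono2) simp
            then show ?thesis unfolding \<theta>_def t by blast
          qed
          then show ?thesis by force
        qed
        then show ?thesis unfolding v_def \<theta> \<theta>_def[symmetric] filter_filter
          by (intro filter_cong) auto
      qed
      ultimately show ?thesis by simp
    qed
    ultimately show ?thesis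
      using length_out_pow_filter by metis
  qed
  then have mono: "length ((out (<) ^^ (k + e)) (v 0 @ X 0)) \<le> length ((out (<) ^^ (k + e)) (v q @ X q))" for q
    using lift_Suc_mono_le[of "\<lambda>q. length ((out (<) ^^ (k + e)) (v q @ X q))" 0 q] by simp
  have v0: "v 0 = filter (\<lambda>a. a \<in> S) w"
    unfolding v_def using mult by (intro filter_cong) auto
  have "length ((out (<) ^^ (k + e)) (v 0 @ X 0)) = length ((out (<) ^^ e) (v 0))"
  proof -
    \<comment> \<open>The filler for \<open>q = 0\<close> has the values \<open>1\<close> to
      \<open>k\<close>, below every positive multiple of \<open>k + 1\<close>.\<close>
    have "c < x" if "x \<in> set (v 0)" "c \<in> {0<..k}" for c x
      using that mult by (auto simp: v_def dest!: dvd_imp_le)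
    moreover have "length (v 0) \<le> n" by (simp add: v_def n_def)
    ultimately show ?thesis
      using length_out_pow_blocks[of "levels 0 k" "v 0" n e] levels[of 0 k] by (simp add: X_def)
  qed
  moreover have "\<exists>q. (out (<) ^^ (k + e)) (v q @ X q) = (out (<) ^^ (k + e)) w"
  proof -
    \<comment> \<open>The sum serves as an upper bound for all letters.\<close>
    define q where "q = sum_list w"
    have le: "\<forall>a\<in>set w. a \<le> Suc k * q"
      using member_le_sum_list[of _ w] by (fastforce simp: q_def)
    then have vq: "v q = w" by (auto simp: v_def filter_id_conv)
    \<comment> \<open>Relabelling by the identity supplies bounds: a filler letter emerging below
      row \<open>k\<close> would be both at most \<open>Suc k * q + k\<close> and larger than
      that.\<close>
    let ?A = "{a. a \<le> Suc k * q + k}"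
    have "strict_mono_on ?A (\<lambda>a. a)" by (simp add: strict_mono_on_def)
    moreover have "\<forall>i<k. \<forall>a\<in>set (row (<) ((out (<) ^^ i) w)). a \<in> ?A \<and> a = a"
    proof (intro allI impI ballI conjI)
      fix i a assume "a \<in> set (row (<) ((out (<) ^^ i) w))"
      then have "a \<in> set w" using set_row_out set_out_pow by fast
      then show "a \<in> ?A" using le by auto
    qed simp
    ultimately obtain Y where "(out (<) ^^ k) (w @ X q) = (out (<) ^^ k) w @ Y"
      "set Y \<subseteq> ?A" "\<forall>y\<in>set Y. Suc k * q + 1 + k \<le> y"
      using out_pow_relabel[of ?A "\<lambda>a. a" k w "X q" "Suc k * q + 1"] X[of q] by fastforce
    moreover from this have "Y = []" by (cases Y) auto
    ultimately have "(out (<) ^^ k) (v q @ X q) = (out (<) ^^ k) w" using vq by simp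
    then show ?thesis by (intro exI[of _ q]) (simp add: funpow_add add.commute[of k e])
  qed
  ultimately show ?thesis using mono v0 by metis
qed

section \<open>Standardisation and the tableau algorithm\<close>

abbreviation lt_fst :: "'a :: linorder \<times> nat \<Rightarrow> 'a \<times> nat \<Rightarrow> bool" where
  "lt_fst a b \<equiv> fst a < fst b"

definition lt_lex :: "'a :: linorder \<times> nat \<Rightarrow> 'a \<times> nat \<Rightarrow> bool" where
  "lt_lex a b \<longleftrightarrow> fst a < fst b \<or> fst a = fst b \<and> snd a < snd b"

definition ties_ordered :: "('a :: linorder \<times> nat) list \<Rightarrow> bool" where
  "ties_ordered = sorted_wrt (\<lambda>a b. fst a = fst b \<longrightarrow> snd a < snd b)"

text \<open>Comparing letters only, or breaking ties by position, makes no difference as long as equal letters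
  enter each row in the order of their positions.\<close>

lemma run_lt_lex:
  assumes "ties_ordered (us @ r @ w)" "sorted (map fst r)"
  shows "run lt_lex r w = run lt_fst r w \<and> ties_ordered (us @ snd (run lt_fst r w))"
  using assms
proof (induction w arbitrary: us r)
  case Nil
  then show ?case by (auto simp: ties_ordered_def sorted_wrt_append)
next
  case (Cons a w)
  have "lt_lex a b \<longleftrightarrow> lt_fst a b" if "b \<in> set r" for b
  proof -
    have "fst b = fst a \<longrightarrow> snd b < snd a"
      using Cons.prems(1) that unfolding ties_ordered_def sorted_wrt_append by simp
    then show ?thesis by (auto simp: lt_lex_def)
  qed
  then have eq: "bump lt_lex a r = bump lt_fst a r"
    using bump_map[of r lt_lex id a lt_fst] by (simp add: list.map_id0 option.map_id0 prod.map_id0)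
  show ?case
  proof (rule bump_cases[of lt_fst a r])
    assume b: "bump lt_fst a r = (r @ [a], None)" "\<forall>x\<in>set r. \<not> lt_fst a x"
    have "run lt_lex (r @ [a]) w = run lt_fst (r @ [a]) w \<and>
        ties_ordered (us @ snd (run lt_fst (r @ [a]) w))"
      by (rule Cons.IH) (use Cons.prems b(2) in \<open>auto simp: sorted_append not_less\<close>)
    then show ?thesis using b eq by (auto split: prod.splits)
  next
    fix u b v
    assume b: "r = u @ b # v" "bump lt_fst a r = (u @ a # v, Some b)"
      "\<forall>x\<in>set u. \<not> lt_fst a x" "lt_fst a b"
    \<comment> \<open>Letters equal to \<open>b\<close> can only stand behind it in the row, so
      moving \<open>b\<close> out to the front keeps ties in order.\<close>
    have v: "\<forall>x\<in>set v. fst a < fst x" "\<forall>x\<in>set u. fst x < fst b"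
      using Cons.prems(2) b by (auto simp: sorted_append not_less intro: less_le_trans le_less_trans)
    have "run lt_lex (u @ a # v) w = run lt_fst (u @ a # v) w \<and>
        ties_ordered ((us @ [b]) @ snd (run lt_fst (u @ a # v) w))"
    proof (rule Cons.IH)
      show "ties_ordered ((us @ [b]) @ (u @ a # v) @ w)"
        using Cons.prems(1) v b(1) by (auto simp: ties_ordered_def sorted_wrt_append)
      show "sorted (map fst (u @ a # v))"
        using Cons.prems(2) v b by (auto simp: sorted_append not_less less_imp_le)
    qed
    then show ?thesis using b eq by (auto split: prod.splits)
  qed
qed

lemma out_lt_lex:
  assumes "ties_ordered w"
  shows "(out lt_lex ^^ j) w = (out lt_fst ^^ j) w \<and> ties_ordered ((out lt_fst ^^ j) w)"
proof (induction j)
  case (Suc j)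
  have "out lt_lex v = out lt_fst v \<and> ties_ordered (out lt_fst v)" if "ties_ordered v" for v :: "('a \<times> nat) list"
    using run_lt_lex[of "[]" "[]" v] that by (simp add: out_def)
  then show ?case using Suc by simp
qed (use assms in simp)

text \<open>The rank of an entry is shifted by one to be positive and stretched by
  \<open>k + 1\<close> to leave room for the fillers.\<close>

lemma lex_rank:
  fixes E :: "('a :: linorder \<times> nat) set"
  assumes "finite E"
  shows "\<exists>f :: 'a \<times> nat \<Rightarrow> nat. (\<forall>a\<in>E. \<forall>b\<in>E. f a < f b \<longleftrightarrow> lt_lex a b) \<and> (\<forall>a. Suc k dvd f a \<and> 0 < f a)"
proof -
  let ?c = "\<lambda>a. card {b\<in>E. lt_lex b a}"
  let ?f = "\<lambda>a. Suc k * Suc (?c a)"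
  have "?f a < ?f b \<longleftrightarrow> lt_lex a b" if a: "a \<in> E" and b: "b \<in> E" for a b
  proof -
    have less: "?c a < ?c b" if "lt_lex a b" "a \<in> E" for a b
    proof (rule psubset_card_mono)
      show "{x\<in>E. lt_lex x a} \<subset> {x\<in>E. lt_lex x b}"
        using that by (auto simp: lt_lex_def)
    qed (use assms in simp)
    have "lt_lex a b \<or> a = b \<or> lt_lex b a"
      by (auto simp: lt_lex_def prod_eq_iff)
    then have "?c a < ?c b \<longleftrightarrow> lt_lex a b"
      using less[of a b] less[of b a] a b by (auto simp: lt_lex_def)
    then show ?thesis
      by (simp only: mult_less_cancel1 Suc_less_eq) simp
  qed
  moreover have "Suc k dvd ?f a \<and> 0 < ?f a" for a
    by (intro conjI dvd_triv_left mult_pos_pos) simp_all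
  ultimately show ?thesis by (intro exI[of _ ?f]) blast
qed

section \<open>RSK processed row by row\<close>

lemma ins_row_eq_bump: "ins_row a r = bump lt_fst a r"
  by (induction r) (auto split: prod.splits)

text \<open>A variable number for the top row allows induction over the rows of the tableau.\<close>

fun ins_word :: "nat \<Rightarrow> ('a :: linorder) tableau \<Rightarrow> 'a entry list \<Rightarrow> 'a tableau \<times> (nat \<times> 'a entry) list" where
  "ins_word i T [] = (T, [])"
| "ins_word i T (a # w) =
     (case ins_tab a i T of (T', ev) \<Rightarrow>
        (case ins_word i T' w of (T'', ev') \<Rightarrow> (T'', ev @ ev')))"

lemma rsk_aux_eq_ins_word: "rsk_aux T w = ins_word 1 T w"
  by (induction w arbitrary: T) (auto split: prod.splits)

lemma ins_tab_levels: "\<forall>e\<in>set (snd (ins_tab a i T)). i \<le> fst e"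
  by (induction a i T rule: ins_tab.induct) (fastforce split: prod.splits option.splits)+

text \<open>The top row evolves independently of the rest, and the rows below see only its bumped
  letters in order. Filtering by row number separates the interleaved events.\<close>

lemma ins_word_Cons_row:
  "fst (ins_word i (r # T) w) = fst (run lt_fst r w) # fst (ins_word (Suc i) T (snd (run lt_fst r w))) \<and>
   filter (\<lambda>e. fst e = i) (snd (ins_word i (r # T) w)) = map (Pair i) (snd (run lt_fst r w)) \<and>
   filter (\<lambda>e. fst e \<noteq> i) (snd (ins_word i (r # T) w)) = snd (ins_word (Suc i) T (snd (run lt_fst r w)))"
proof (induction w arbitrary: r T)
  case (Cons a w)
  obtain r' c where b: "bump lt_fst a r = (r', c)" by fastforce
  show ?case
  proof (cases c)
    case None
    then show ?thesis using Cons.IH[of r' T] b by (auto simp: ins_row_eq_bump split: prod.splits)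
  next
    case (Some d)
    obtain T' ev where T': "ins_tab d (Suc i) T = (T', ev)" by fastforce
    have "\<forall>e\<in>set ev. fst e \<noteq> i" using ins_tab_levels[of d "Suc i" T] T' by fastforce
    then have "filter (\<lambda>e. fst e = i) ev = []" "filter (\<lambda>e. fst e \<noteq> i) ev = ev"
      by (auto simp: filter_empty_conv filter_id_conv)
    then show ?thesis
      using Cons.IH[of r' T'] b Some T' by (auto simp: ins_row_eq_bump split: prod.splits)
  qed
qed simp

lemma ins_word_Nil: "w \<noteq> [] \<Longrightarrow> ins_word i [] w = ins_word i [[]] w"
  by (cases w) auto

lemma ins_word_Nil_out:
  assumes "w \<noteq> []"
  shows "fst (ins_word i [] w) = row lt_fst w # fst (ins_word (Suc i) [] (out lt_fst w))"
    "filter (\<lambda>e. fst e = i) (snd (ins_word i [] w)) = map (Pair i) (out lt_fst w)"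
    "filter (\<lambda>e. fst e \<noteq> i) (snd (ins_word i [] w)) = snd (ins_word (Suc i) [] (out lt_fst w))"
  using ins_word_Cons_row[of i "[]" "[]" w] ins_word_Nil[OF assms] by (simp_all add: row_def out_def)

lemma ins_word_shape:
  "sum_list (take j (map length (fst (ins_word i [] w)))) + length ((out lt_fst ^^ j) w) = length w"
proof (induction j arbitrary: i w)
  case (Suc j)
  show ?case
  proof (cases "w = []")
    case False
    then show ?thesis
      using Suc[of "Suc i" "out lt_fst w"] ins_word_Nil_out(1)[OF False, of i] length_row_out[of lt_fst w]
      by (simp add: out_pow_Suc del: funpow.simps)
  qed simp
qed simp

lemma ins_word_size: "sum_list (map length (fst (ins_word i [] w))) = length w"
proof -
  let ?s = "map length (fst (ins_word i [] w))"
  \<comment> \<open>This many rows include the whole shape and leave no bumped letters.\<close>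
  have "sum_list (take (length ?s + length w) ?s) = length w"
    using ins_word_shape[of "length ?s + length w" i w] out_pow_eq_Nil[of w "length ?s + length w" lt_fst] by simp
  then show ?thesis by simp
qed

text \<open>A letter leaving row \<open>i + d\<close> has passed through \<open>d + 1\<close> rows,
  counted from the top row \<open>i\<close>.\<close>

lemma ins_word_events:
  "map snd (filter (\<lambda>e. fst e = i + d) (snd (ins_word i [] w))) = (out lt_fst ^^ Suc d) w"
proof (induction d arbitrary: i w)
  case 0
  show ?case
  proof (cases "w = []")
    case False
    then show ?thesis using ins_word_Nil_out(2)[OF False, of i] by (simp add: comp_def)
  qed simp
next
  case (Suc d)
  show ?case
  proof (cases "w = []")
    case False
    have "filter (\<lambda>e. fst e = i + Suc d) (snd (ins_word i [] w))
      = filter (\<lambda>e. fst e = Suc i + d) (filter (\<lambda>e. fst e \<noteq> i) (snd (ins_word i [] w)))"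
      by (auto simp: filter_filter intro: filter_cong)
    then show ?thesis
      using Suc[of "Suc i" "out lt_fst w"] ins_word_Nil_out(3)[OF False, of i]
      by (simp only: out_pow_Suc)
  qed (simp add: out_pow_Nil del: funpow.simps)
qed

lemma map_fst_out_pow: "map fst ((out lt_fst ^^ j) z) = (out (<) ^^ j) (map fst z)"
  by (rule out_pow_map[symmetric]) simp

lemma shRSK_take: "sum_list (take j (shRSK y)) = length y - length ((out (<) ^^ j) y)"
proof -
  let ?z = "zip y [0..<length y]"
  have "map fst ((out lt_fst ^^ j) ?z) = (out (<) ^^ j) y"
    using map_fst_out_pow[of j ?z] by simp
  from arg_cong[OF this, of length] have "length ((out (<) ^^ j) y) = length ((out lt_fst ^^ j) ?z)"
    by simp
  then show ?thesis
    using ins_word_shape[of j 1 ?z] by (simp add: shRSK_def rsk_run_def rsk_aux_eq_ins_word)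
qed

lemma shRSK_size: "sum_list (shRSK y) = length y"
  by (simp add: shRSK_def rsk_run_def rsk_aux_eq_ins_word ins_word_size)

lemma bumped_entries:
  assumes "k \<ge> 1"
  shows "[b. (j, b) \<leftarrow> snd (rsk_run x), j = k] = (out lt_fst ^^ k) (zip x [0..<length x])"
proof -
  have "[b. (j, b) \<leftarrow> ev, j = k] = map snd (filter (\<lambda>e. fst e = k) ev)" for ev :: "(nat \<times> 'a entry) list"
    by (induction ev) auto
  then show ?thesis
    using ins_word_events[of 1 "k - 1" "zip x [0..<length x]"] assms
    by (simp add: rsk_run_def rsk_aux_eq_ins_word)
qed

text \<open>Standardisation: the lexicographic rank makes all letters distinct without changing any
  bump. Restriction keeps ties in order, so one ranking serves for both words.\<close>

lemma length_out_pow_restrict_entries: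
  fixes z :: "('a :: linorder \<times> nat) list" and k :: nat
  assumes "ties_ordered z" "distinct z"
  defines "B \<equiv> set ((out lt_fst ^^ k) z)"
  shows "length ((out lt_fst ^^ e) (filter (\<lambda>a. a \<in> B) z)) \<le> length ((out lt_fst ^^ (k + e)) z)"
proof -
  obtain f :: "'a \<times> nat \<Rightarrow> nat" where f: "\<forall>a\<in>set z. \<forall>b\<in>set z. f a < f b \<longleftrightarrow> lt_lex a b"
    "\<forall>a. Suc k dvd f a \<and> 0 < f a"
    using lex_rank[of "set z" k] by auto
  have inj: "inj_on f (set z)"
  proof (rule inj_onI)
    fix a b assume "a \<in> set z" "b \<in> set z" "f a = f b"
    then have "\<not> lt_lex a b" "\<not> lt_lex b a" using f(1) by (metis less_irrefl)+
    then show "a = b" by (auto simp: lt_lex_def prod_eq_iff)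
  qed
  have lex: "(out (<) ^^ j) (map f y) = map f ((out lt_fst ^^ j) y)"
    if "ties_ordered y" "set y \<subseteq> set z" for j y
    using out_pow_map[of y "(<)" f lt_lex j] out_lt_lex[OF that(1), of j] f(1) that(2) by auto
  define w where "w = map f z"
  have "set ((out (<) ^^ k) w) = f ` B"
    using lex[OF assms(1), of k] by (simp add: w_def B_def)
  moreover have "B \<subseteq> set z" unfolding B_def by (rule set_out_pow)
  ultimately have "filter (\<lambda>a. a \<in> set ((out (<) ^^ k) w)) w = map f (filter (\<lambda>a. a \<in> B) z)"
    unfolding w_def filter_map comp_def using inj
    by (intro arg_cong[where f = "map f"] filter_cong) (auto simp: inj_on_image_mem_iff)
  moreover have "ties_ordered (filter (\<lambda>a. a \<in> B) z)"
    using assms(1) by (simp add: ties_ordered_def sorted_wrt_filter)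
  ultimately have "length ((out lt_fst ^^ e) (filter (\<lambda>a. a \<in> B) z)) =
      length ((out (<) ^^ e) (filter (\<lambda>a. a \<in> set ((out (<) ^^ k) w)) w))"
    using lex[of "filter (\<lambda>a. a \<in> B) z" e] by auto
  also have "\<dots> \<le> length ((out (<) ^^ (k + e)) w)"
    by (rule length_out_pow_restrict_bumped)
      (use inj assms(2) f(2) in \<open>auto simp: w_def distinct_map\<close>)
  also have "\<dots> = length ((out lt_fst ^^ (k + e)) z)"
    using lex[OF assms(1), of "k + e"] by (simp add: w_def)
  finally show ?thesis .
qed

theorem mainTheorem8:
  fixes k :: nat and x :: "'a::linorder list"
  assumes "k \<ge> 1"
  shows "dominates (shRSK (xbar k x)) (shRSK (bumped_word k x))"
proof -
  define z where "z = zip x [0..<length x]"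
  define B where "B = set ((out lt_fst ^^ k) z)"
  have z: "distinct z" "inj_on snd (set z)" "ties_ordered z"
  proof -
    have "distinct (map snd z)" by (simp add: z_def)
    then show "distinct z" "inj_on snd (set z)" by (simp_all add: distinct_map)
    have "sorted_wrt (\<lambda>a b. snd a < snd b) z"
      using sorted_wrt_map[of "(<)" snd z] by (simp add: z_def sorted_wrt_upt)
    then show "ties_ordered z"
      unfolding ties_ordered_def by (rule sorted_wrt_mono_rel[rotated]) simp
  qed
  have "B \<subseteq> set z" unfolding B_def by (rule set_out_pow)
  have bumped: "[b. (j, b) \<leftarrow> snd (rsk_run x), j = k] = (out lt_fst ^^ k) z"
    using bumped_entries[OF assms] by (simp add: z_def)
  have "[fst b. (j, b) \<leftarrow> ev, j = k] = map fst [b. (j, b) \<leftarrow> ev, j = k]" for ev :: "(nat \<times> 'a entry) list"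
    by (induction ev) auto
  then have "bumped_word k x = map fst [b. (j, b) \<leftarrow> snd (rsk_run x), j = k]"
    unfolding bumped_word_def .
  then have word: "bumped_word k x = map fst ((out lt_fst ^^ k) z)" using bumped by simp
  have "bumped_positions k x = snd ` B"
    unfolding B_def bumped[symmetric] bumped_positions_def by force
  then have xbar: "xbar k x = map fst (filter (\<lambda>a. a \<in> B) z)"
    unfolding xbar_def nths_def z_def[symmetric] using z(2) \<open>B \<subseteq> set z\<close>
    by (intro arg_cong[where f = "map fst"] filter_cong) (auto simp: inj_on_image_mem_iff)
  \<comment> \<open>Both words consist of exactly the occurrences in \<open>B\<close>, each once;
    this gives the equal sizes demanded by dominance.\<close>
  have len: "length (xbar k x) = length (bumped_word k x)"
  proof -
    have "set (filter (\<lambda>a. a \<in> B) z) = set ((out lt_fst ^^ k) z)"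
      using \<open>B \<subseteq> set z\<close> by (auto simp: B_def)
    then show ?thesis
      using distinct_card[OF distinct_filter[OF z(1)]] distinct_card[OF distinct_out_pow[OF z(1)]]
      by (metis length_map word xbar)
  qed
  \<comment> \<open>Bumping the \<open>k\<close>th bumped word through \<open>j\<close> further rows
    is bumping \<open>x\<close> through \<open>k + j\<close> rows.\<close>
  have "length ((out (<) ^^ j) (xbar k x)) \<le> length ((out (<) ^^ j) (bumped_word k x))" for j
    using length_out_pow_restrict_entries[OF z(3,1), of j k]
    by (simp add: xbar word B_def funpow_add add.commute[of k] flip: map_fst_out_pow)
  then show ?thesis
    unfolding dominates_def shRSK_take shRSK_size len by (simp add: diff_le_mono2)
qed

end
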